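(* Let $(A,\diamond_A,\alpha)$ be a regular admissible Hom-Poisson algebra ($\alpha$ invertible), and suppose that there is an admissible Hom-Poisson algebra structure $(A^*,\diamond_{A^*},\alpha_{A^*})$, $\alpha_{A^*}=(\alpha^{-1})^*$, on the dual space, whose product is given by a linear map $\Delta^*:A^*\otimes A^*\to A^*$, the dual of a linear map $\Delta:A\to A\otimes A$. Then $(A,A^*,-R_A^\star,-L_A^\star,-R_{A^*}^\star,-L_{A^*}^\star,\alpha,\alpha_{A^*})$ is a matched pair of admissible Hom-Poisson algebras if and only if $\Delta$ satisfies, for all $x,y\in A$, the following three equations, where $\tau(u\otimes v)=v\otimes u$: (i) $\Delta(x\diamond_A y)-(R_A(\alpha^{-1}(y))\otimes\alpha)\Delta(x)-(\alpha\otimes L_A(\alpha^{-1}(x)))\Delta(y)=\frac13\Big((L_A(\alpha^{-1}(y))\otimes\alpha)\Delta(x)-(\alpha\otimes L_A(\alpha^{-1}(y)))\Delta(x)+(L_A(\alpha^{-1}(x))\otimes\alpha)\Delta(y)-(R_A(\alpha^{-1}(x))\otimes\alpha)\Delta(y)+\tau\big(-\Delta(x\diamond_A y)+(L_A(\alpha^{-1}(x))\otimes\alpha)\Delta(y)+(L_A(\alpha^{-1}(y))\otimes\alpha)\Delta(x)\big)\Big)$; (ii) $\Delta(x\diamond_A y)-(R_A(\alpha^{-1}(x))\otimes\alpha)\Delta(y)-(\alpha\otimes L_A(\alpha^{-1}(y)))\Delta(x)=\frac13\Big(\tau\big((L_A(\alpha^{-1}(x))\otimes\alpha)\Delta(y)+(L_A(\alpha^{-1}(y))\otimes\alpha)\Delta(x)-(R_A(\alpha^{-1}(y))\otimes\alpha)\Delta(x)-(\alpha\otimes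 L_A(\alpha^{-1}(x)))\Delta(y)\big)-\Delta(y\diamond_A x)+(L_A(\alpha^{-1}(x))\otimes\alpha)\Delta(y)+(L_A(\alpha^{-1}(y))\otimes\alpha)\Delta(x)\Big)$; (iii) $(\alpha\otimes R_A(\alpha^{-1}(y)))\Delta(x)-(L_A(\alpha^{-1}(y))\otimes\alpha)\Delta(x)+\tau\big((\alpha\otimes R_A(\alpha^{-1}(x)))\Delta(y)-(L_A(\alpha^{-1}(x))\otimes\alpha)\Delta(y)\big)=\frac13\Big((R_A(\alpha^{-1}(y))\otimes\alpha)\Delta(x)-(\alpha\otimes L_A(\alpha^{-1}(y)))\Delta(x)+(\alpha\otimes L_A(\alpha^{-1}(x)))\Delta(y)-(R_A(\alpha^{-1}(x))\otimes\alpha)\Delta(y)+\tau\big(\Delta(y\diamond_A x)-\Delta(x\diamond_A y)\big)\Big)$.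
   Context: All vector spaces are finite-dimensional over a field $\mathbb F$ in which $3$ is invertible. An admissible Hom-Poisson algebra is a triple $(A,\diamond,\alpha)$ consisting of a vector space $A$, a bilinear operation $\diamond:A\otimes A\to A$ and a linear map $\alpha:A\to A$ with $\alpha(x\diamond y)=\alpha(x)\diamond\alpha(y)$ (multiplicativity, a standing assumption) such that for all $x,y,z\in A$ $$(x\diamond y)\diamond \alpha(z)=\alpha(x)\diamond(y\diamond z)-\tfrac13\big(-\alpha(x)\diamond (z\diamond y)+\alpha(z)\diamond( x\diamond y)+\alpha(y)\diamond (x\diamond z)- \alpha(y)\diamond(z\diamond x)\big).$$ It is regular if $\alpha$ is invertible. A representation of $(A,\diamond,\alpha)$ is a quadruple $(V,\rho,\mu,\beta)$ with $V$ a vector space, $\beta\in\mathrm{End}(V)$ and $\rho,\mu:A\to\mathrm{End}(V)$ linear maps such that for all $x,y\in A$ (juxtaposition is composition): $$\rho(\alpha(x))\beta=\beta\rho(x),\qquad \mu(\alpha(x))\beta=\beta\mu(x),$$ $$\rho(x\diamond y)\beta=\rho(\alpha(x))\rho(y)-\tfrac13\big(-\rho(\alpha(x))\mu(y)+\mu(x\diamond y)\beta+\rho(\alpha(y))\rho(x)-\rho(\alpha(y))\mu(x)\big),$$ $$\mu(\alpha(y))\rho(x)=\rho(\alpha(x))\mu(y)-\tfrac13\big(-\rho(\alpha(x))\rho(y)+\rho(\alpha(y))\rho(x)+\mu(x\diamond y)\beta-\mu(y\diamond x)\beta\big),$$ $$\mu(\alpha(y))\mu(x)=\mu(x\diamond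 y)\beta-\tfrac13\big(-\mu(y\diamond x)\beta+\rho(\alpha(y))\mu(x)+\rho(\alpha(x))\mu(y)-\rho(\alpha(x))\rho(y)\big).$$ Matched pair: given admissible Hom-Poisson algebras $(A_1,\diamond_1,\alpha_1)$, $(A_2,\diamond_2,\alpha_2)$ and linear maps $\rho_1,\mu_1:A_1\to\mathrm{End}(A_2)$, $\rho_2,\mu_2:A_2\to\mathrm{End}(A_1)$, the tuple $(A_1,A_2,\rho_1,\mu_1,\rho_2,\mu_2,\alpha_1,\alpha_2)$ is a matched pair of admissible Hom-Poisson algebras if $(A_2,\rho_1,\mu_1,\alpha_2)$ is a representation of $(A_1,\diamond_1,\alpha_1)$, $(A_1,\rho_2,\mu_2,\alpha_1)$ is a representation of $(A_2,\diamond_2,\alpha_2)$, and for all $x,y\in A_1$, $a,b\in A_2$: (M1) $\mu_2(\alpha_2(a))(x\diamond_1y)=\mu_2(\rho_1(y)a)(\alpha_1(x))+\alpha_1(x)\diamond_1(\mu_2(a)y)+\frac13\big(\mu_2(\mu_1(y)a)(\alpha_1(x))+\alpha_1(x)\diamond_1(\rho_2(a)y)-\rho_2(a)(\alpha_1(x)\diamond_1y)-\alpha_1(y)\diamond_1(\mu_2(a)x)-\mu_2(\rho_1(x)a)(\alpha_1(y))+\alpha_1(y)\diamond_1(\rho_2(a)x)+\mu_2(\mu_1(x)a)(\alpha_1(y))\big)$; (M2) $\rho_2(\alpha_2(a))(x\diamond_1y)=(\rho_2(a)x)\diamond_1\alpha_1(y)+\rho_2(\mu_1(x)a)(\alpha_1(y))+\frac13\big(-\rho_2(a)(\alpha_1(y)\diamond_1x)+\alpha_1(y)\diamond_1(\rho_2(a)x)+\mu_2(\mu_1(x)a)(\alpha_1(y))+\alpha_1(x)\diamond_1(\rho_2(a)y)+\mu_2(\mu_1(y)a)(\alpha_1(x))-\alpha_1(x)\diamond_1(\mu_2(a)y)-\mu_2(\rho_1(y)a)(\alpha_1(x))\big)$;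 (M3) $(\mu_2(a)x)\diamond_1\alpha_1(y)=-\rho_2(\rho_1(x)a)(\alpha_1(y))+\alpha_1(x)\diamond_1(\rho_2(a)y)+\mu_2(\mu_1(y)a)(\alpha_1(x))+\frac13\big(\alpha_1(x)\diamond_1(\mu_2(a)y)+\mu_2(\rho_1(y)a)(\alpha_1(x))-\alpha_1(y)\diamond_1(\mu_2(a)x)-\mu_2(\rho_1(x)a)(\alpha_1(y))-\rho_2(\alpha_2(a))(x\diamond_1y)+\rho_2(\alpha_2(a))(y\diamond_1x)\big)$; (M4) $\mu_1(\alpha_1(x))(a\diamond_2b)=\mu_1(\rho_2(b)x)(\alpha_2(a))+\alpha_2(a)\diamond_2(\mu_1(x)b)+\frac13\big(\mu_1(\mu_2(b)x)(\alpha_2(a))+\alpha_2(a)\diamond_2(\rho_1(x)b)-\rho_1(x)(\alpha_2(a)\diamond_2b)-\alpha_2(b)\diamond_2(\mu_1(x)a)-\mu_1(\rho_2(a)x)(\alpha_2(b))+\alpha_2(b)\diamond_2(\rho_1(x)a)+\mu_1(\mu_2(a)x)(\alpha_2(b))\big)$; (M5) $\rho_1(\alpha_1(x))(a\diamond_2b)=(\rho_1(x)a)\diamond_2\alpha_2(b)+\rho_1(\mu_2(a)x)(\alpha_2(b))+\frac13\big(-\rho_1(\alpha_1(x))(b\diamond_2a)+\alpha_2(b)\diamond_2(\rho_1(x)a)+\mu_1(\mu_2(a)x)(\alpha_2(b))+\alpha_2(a)\diamond_2(\rho_1(x)b)+\mu_1(\mu_2(b)x)(\alpha_2(a))-\alpha_2(a)\diamond_2(\mu_1(x)b)-\mu_1(\rho_2(b)x)(\alpha_2(a))\big)$;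 (M6) $(\mu_1(x)a)\diamond_2\alpha_2(b)=-\rho_1(\rho_2(a)x)(\alpha_2(b))+\alpha_2(a)\diamond_2(\rho_1(x)b)+\mu_1(\mu_2(b)x)(\alpha_2(a))+\frac13\big(\alpha_2(a)\diamond_2(\mu_1(x)b)+\mu_1(\rho_2(b)x)(\alpha_2(a))-\alpha_2(b)\diamond_2(\mu_1(x)a)-\mu_1(\rho_2(a)x)(\alpha_2(b))-\rho_1(\alpha_1(x))(a\diamond_2b)+\rho_1(\alpha_1(x))(b\diamond_2a)\big)$. Duals: for a linear map $T$, $T^*$ is the dual map, $\langle T^*(w^* ),v\rangle=\langle w^*,T(v)\rangle$; for $\rho:A\to\mathrm{End}(V)$, $\rho^*:A\to\mathrm{End}(V^* )$ is given by $\langle\rho^*(x)\xi,v\rangle=-\langle\xi,\rho(x)v\rangle$. $L_A(x)y=x\diamond_A y$, $R_A(x)y=y\diamond_A x$, and similarly $L_{A^*},R_{A^*}$ for $\diamond_{A^*}$. For $x\in A$, $\xi\in A^*$: $L_A^\star(x)\xi=L_A^*(\alpha(x))\big((\alpha^{-2})^*\xi\big)$, $R_A^\star(x)\xi=R_A^*(\alpha(x))\big((\alpha^{-2})^*\xi\big)$, and (identifying $A^{**}=A$) $L_{A^*}^\star(\xi)x=L_{A^*}^*\big((\alpha^{-1})^*\xi\big)(\alpha^2(x))$, $R_{A^*}^\star(\xi)x=R_{A^*}^*\big((\alpha^{-1})^*\xi\big)(\alpha^2(x))$.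
   Formalization: Misprints corrected: (ii)'s left side is taken equal to (i)'s (x,y swapped in the two subtracted terms); bracket terms in (M1),(M2),(M4) read −ρ2(α2(a))(x⋄y), −ρ2(α2(a))(y⋄x), −ρ1(α1(x))(a⋄b). As printed the claim fails, e.g. for a 2-dimensional Lie bialgebra and its Yau twist. *)

theory Defs
  imports Complex_Main "HOL-Library.Function_Algebras"
begin

section \<open>Vector spaces and linear maps relative to a carrier\<close>

text \<open>
  A vector space is a subspace \<open>V\<close> of a type carrying a scalar multiplication \<open>s\<close>. The carrier is
  explicit because the dual space is only a subset of the type of all scalar-valued functions
  (whose addition is pointwise, by \<open>Function_Algebras\<close>). Maps between vector spaces are HOL
  functions of which only the values on the carrier matter.
\<close>

definition fin_dim_space :: "('f::field \<Rightarrow> 'v::ab_group_add \<Rightarrow> 'v) \<Rightarrow> 'v set \<Rightarrow> bool" where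
  "fin_dim_space s V \<longleftrightarrow>
     vector_space s \<and> module.subspace s V \<and> (\<exists>B. finite B \<and> module.span s B = V)"

definition linear_map_on ::
  "('f::field \<Rightarrow> 'v::ab_group_add \<Rightarrow> 'v) \<Rightarrow> 'v set \<Rightarrow> ('f \<Rightarrow> 'w::ab_group_add \<Rightarrow> 'w) \<Rightarrow> 'w set
    \<Rightarrow> ('v \<Rightarrow> 'w) \<Rightarrow> bool" where
  "linear_map_on s V t W f \<longleftrightarrow>
     (\<forall>x\<in>V. f x \<in> W) \<and>
     (\<forall>x\<in>V. \<forall>y\<in>V. f (x + y) = f x + f y) \<and>
     (\<forall>c. \<forall>x\<in>V. f (s c x) = t c (f x))"

text \<open>
  A linear map from \<open>V\<close> to \<open>End(W)\<close> is, uncurried, the same thing as a bilinear map from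
  \<open>V \<times> W\<close> to \<open>W\<close>, so \<open>bilinear_map_on\<close> is used both for products and for actions.
\<close>

definition bilinear_map_on ::
  "('f::field \<Rightarrow> 'v::ab_group_add \<Rightarrow> 'v) \<Rightarrow> 'v set \<Rightarrow> ('f \<Rightarrow> 'w::ab_group_add \<Rightarrow> 'w) \<Rightarrow> 'w set
    \<Rightarrow> ('f \<Rightarrow> 'u::ab_group_add \<Rightarrow> 'u) \<Rightarrow> 'u set \<Rightarrow> ('v \<Rightarrow> 'w \<Rightarrow> 'u) \<Rightarrow> bool" where
  "bilinear_map_on s V t W r U f \<longleftrightarrow>
     (\<forall>x\<in>V. linear_map_on t W r U (f x)) \<and>
     (\<forall>y\<in>W. linear_map_on s V r U (\<lambda>x. f x y))"


section \<open>Admissible Hom-Poisson algebras, representations, matched pairs\<close>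

text \<open>In this section the characteristic of the field is meant to be different from 3.\<close>

definition admissible_hom_poisson ::
  "('f::field \<Rightarrow> 'v::ab_group_add \<Rightarrow> 'v) \<Rightarrow> 'v set \<Rightarrow> ('v \<Rightarrow> 'v \<Rightarrow> 'v) \<Rightarrow> ('v \<Rightarrow> 'v) \<Rightarrow> bool" where
  "admissible_hom_poisson s A m \<alpha> \<longleftrightarrow>
     fin_dim_space s A \<and>
     bilinear_map_on s A s A s A m \<and>
     linear_map_on s A s A \<alpha> \<and>
     (\<forall>x\<in>A. \<forall>y\<in>A. \<alpha> (m x y) = m (\<alpha> x) (\<alpha> y)) \<and>
     (\<forall>x\<in>A. \<forall>y\<in>A. \<forall>z\<in>A.
        m (m x y) (\<alpha> z) =
          m (\<alpha> x) (m y z)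
          - s (1/3) (- m (\<alpha> x) (m z y) + m (\<alpha> z) (m x y) + m (\<alpha> y) (m x z) - m (\<alpha> y) (m z x)))"

definition regular_admissible_hom_poisson ::
  "('f::field \<Rightarrow> 'v::ab_group_add \<Rightarrow> 'v) \<Rightarrow> 'v set \<Rightarrow> ('v \<Rightarrow> 'v \<Rightarrow> 'v) \<Rightarrow> ('v \<Rightarrow> 'v) \<Rightarrow> bool" where
  "regular_admissible_hom_poisson s A m \<alpha> \<longleftrightarrow>
     admissible_hom_poisson s A m \<alpha> \<and> bij_betw \<alpha> A A"

definition hom_poisson_rep ::
  "('f::field \<Rightarrow> 'v::ab_group_add \<Rightarrow> 'v) \<Rightarrow> 'v set \<Rightarrow> ('v \<Rightarrow> 'v \<Rightarrow> 'v) \<Rightarrow> ('v \<Rightarrow> 'v)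
    \<Rightarrow> ('f \<Rightarrow> 'w::ab_group_add \<Rightarrow> 'w) \<Rightarrow> 'w set
    \<Rightarrow> ('v \<Rightarrow> 'w \<Rightarrow> 'w) \<Rightarrow> ('v \<Rightarrow> 'w \<Rightarrow> 'w) \<Rightarrow> ('w \<Rightarrow> 'w) \<Rightarrow> bool" where
  "hom_poisson_rep s A m \<alpha> t V \<rho> \<mu> \<beta> \<longleftrightarrow>
     fin_dim_space t V \<and>
     linear_map_on t V t V \<beta> \<and>
     bilinear_map_on s A t V t V \<rho> \<and>
     bilinear_map_on s A t V t V \<mu> \<and>
     (\<forall>x\<in>A. \<forall>v\<in>V. \<rho> (\<alpha> x) (\<beta> v) = \<beta> (\<rho> x v)) \<and>
     (\<forall>x\<in>A. \<forall>v\<in>V. \<mu> (\<alpha> x) (\<beta> v) = \<beta> (\<mu> x v)) \<and>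
     (\<forall>x\<in>A. \<forall>y\<in>A. \<forall>v\<in>V.
        \<rho> (m x y) (\<beta> v) =
          \<rho> (\<alpha> x) (\<rho> y v)
          - t (1/3) (- \<rho> (\<alpha> x) (\<mu> y v) + \<mu> (m x y) (\<beta> v) + \<rho> (\<alpha> y) (\<rho> x v) - \<rho> (\<alpha> y) (\<mu> x v))) \<and>
     (\<forall>x\<in>A. \<forall>y\<in>A. \<forall>v\<in>V.
        \<mu> (\<alpha> y) (\<rho> x v) =
          \<rho> (\<alpha> x) (\<mu> y v)
          - t (1/3) (- \<rho> (\<alpha> x) (\<rho> y v) + \<rho> (\<alpha> y) (\<rho> x v) + \<mu> (m x y) (\<beta> v) - \<mu> (m y x) (\<beta> v))) \<and>
     (\<forall>x\<in>A. \<forall>y\<in>A. \<forall>v\<in>V.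
        \<mu> (\<alpha> y) (\<mu> x v) =
          \<mu> (m x y) (\<beta> v)
          - t (1/3) (- \<mu> (m y x) (\<beta> v) + \<rho> (\<alpha> y) (\<mu> x v) + \<rho> (\<alpha> x) (\<mu> y v) - \<rho> (\<alpha> x) (\<rho> y v)))"

text \<open>
  The six compatibility conditions below are the mixed components of the admissible Hom-Poisson
  identity for the product
  \<open>(x, a) (y, b) = (m1 x y + \<rho>2 a y + \<mu>2 b x, m2 a b + \<rho>1 x b + \<mu>1 y a)\<close>
  and the twist \<open>(\<alpha>1, \<alpha>2)\<close> on the direct sum. In particular the terms
  \<open>\<rho>2 (\<alpha>2 a) (m1 x y)\<close>, \<open>\<rho>2 (\<alpha>2 a) (m1 y x)\<close> and \<open>\<rho>1 (\<alpha>1 x) (m2 a b)\<close> in the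
  brackets of the first, second and fourth condition have the twist on the acting element; a
  version with \<open>\<rho>2 a (m1 (\<alpha>1 x) y)\<close>, \<open>\<rho>2 a (m1 (\<alpha>1 y) x)\<close> and
  \<open>\<rho>1 x (m2 (\<alpha>2 a) b)\<close> in these three places is a misprint.
\<close>

definition matched_pair ::
  "('f::field \<Rightarrow> 'v::ab_group_add \<Rightarrow> 'v) \<Rightarrow> 'v set \<Rightarrow> ('v \<Rightarrow> 'v \<Rightarrow> 'v)
    \<Rightarrow> ('f \<Rightarrow> 'w::ab_group_add \<Rightarrow> 'w) \<Rightarrow> 'w set \<Rightarrow> ('w \<Rightarrow> 'w \<Rightarrow> 'w)
    \<Rightarrow> ('v \<Rightarrow> 'w \<Rightarrow> 'w) \<Rightarrow> ('v \<Rightarrow> 'w \<Rightarrow> 'w) \<Rightarrow> ('w \<Rightarrow> 'v \<Rightarrow> 'v) \<Rightarrow> ('w \<Rightarrow> 'v \<Rightarrow> 'v)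
    \<Rightarrow> ('v \<Rightarrow> 'v) \<Rightarrow> ('w \<Rightarrow> 'w) \<Rightarrow> bool" where
  "matched_pair s1 A1 m1 s2 A2 m2 \<rho>1 \<mu>1 \<rho>2 \<mu>2 \<alpha>1 \<alpha>2 \<longleftrightarrow>
     admissible_hom_poisson s1 A1 m1 \<alpha>1 \<and>
     admissible_hom_poisson s2 A2 m2 \<alpha>2 \<and>
     hom_poisson_rep s1 A1 m1 \<alpha>1 s2 A2 \<rho>1 \<mu>1 \<alpha>2 \<and>
     hom_poisson_rep s2 A2 m2 \<alpha>2 s1 A1 \<rho>2 \<mu>2 \<alpha>1 \<and>
     (\<forall>x\<in>A1. \<forall>y\<in>A1. \<forall>a\<in>A2.
        \<mu>2 (\<alpha>2 a) (m1 x y) =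
          \<mu>2 (\<rho>1 y a) (\<alpha>1 x) + m1 (\<alpha>1 x) (\<mu>2 a y)
          + s1 (1/3) (\<mu>2 (\<mu>1 y a) (\<alpha>1 x) + m1 (\<alpha>1 x) (\<rho>2 a y) - \<rho>2 (\<alpha>2 a) (m1 x y)
              - m1 (\<alpha>1 y) (\<mu>2 a x) - \<mu>2 (\<rho>1 x a) (\<alpha>1 y) + m1 (\<alpha>1 y) (\<rho>2 a x)
              + \<mu>2 (\<mu>1 x a) (\<alpha>1 y))) \<and>
     (\<forall>x\<in>A1. \<forall>y\<in>A1. \<forall>a\<in>A2.
        \<rho>2 (\<alpha>2 a) (m1 x y) =
          m1 (\<rho>2 a x) (\<alpha>1 y) + \<rho>2 (\<mu>1 x a) (\<alpha>1 y)
          + s1 (1/3) (- \<rho>2 (\<alpha>2 a) (m1 y x) + m1 (\<alpha>1 y) (\<rho>2 a x) + \<mu>2 (\<mu>1 x a) (\<alpha>1 y)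
              + m1 (\<alpha>1 x) (\<rho>2 a y) + \<mu>2 (\<mu>1 y a) (\<alpha>1 x) - m1 (\<alpha>1 x) (\<mu>2 a y)
              - \<mu>2 (\<rho>1 y a) (\<alpha>1 x))) \<and>
     (\<forall>x\<in>A1. \<forall>y\<in>A1. \<forall>a\<in>A2.
        m1 (\<mu>2 a x) (\<alpha>1 y) =
          - \<rho>2 (\<rho>1 x a) (\<alpha>1 y) + m1 (\<alpha>1 x) (\<rho>2 a y) + \<mu>2 (\<mu>1 y a) (\<alpha>1 x)
          + s1 (1/3) (m1 (\<alpha>1 x) (\<mu>2 a y) + \<mu>2 (\<rho>1 y a) (\<alpha>1 x) - m1 (\<alpha>1 y) (\<mu>2 a x)
              - \<mu>2 (\<rho>1 x a) (\<alpha>1 y) - \<rho>2 (\<alpha>2 a) (m1 x y) + \<rho>2 (\<alpha>2 a) (m1 y x))) \<and>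
     (\<forall>x\<in>A1. \<forall>a\<in>A2. \<forall>b\<in>A2.
        \<mu>1 (\<alpha>1 x) (m2 a b) =
          \<mu>1 (\<rho>2 b x) (\<alpha>2 a) + m2 (\<alpha>2 a) (\<mu>1 x b)
          + s2 (1/3) (\<mu>1 (\<mu>2 b x) (\<alpha>2 a) + m2 (\<alpha>2 a) (\<rho>1 x b) - \<rho>1 (\<alpha>1 x) (m2 a b)
              - m2 (\<alpha>2 b) (\<mu>1 x a) - \<mu>1 (\<rho>2 a x) (\<alpha>2 b) + m2 (\<alpha>2 b) (\<rho>1 x a)
              + \<mu>1 (\<mu>2 a x) (\<alpha>2 b))) \<and>
     (\<forall>x\<in>A1. \<forall>a\<in>A2. \<forall>b\<in>A2.
        \<rho>1 (\<alpha>1 x) (m2 a b) =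
          m2 (\<rho>1 x a) (\<alpha>2 b) + \<rho>1 (\<mu>2 a x) (\<alpha>2 b)
          + s2 (1/3) (- \<rho>1 (\<alpha>1 x) (m2 b a) + m2 (\<alpha>2 b) (\<rho>1 x a) + \<mu>1 (\<mu>2 a x) (\<alpha>2 b)
              + m2 (\<alpha>2 a) (\<rho>1 x b) + \<mu>1 (\<mu>2 b x) (\<alpha>2 a) - m2 (\<alpha>2 a) (\<mu>1 x b)
              - \<mu>1 (\<rho>2 b x) (\<alpha>2 a))) \<and>
     (\<forall>x\<in>A1. \<forall>a\<in>A2. \<forall>b\<in>A2.
        m2 (\<mu>1 x a) (\<alpha>2 b) =
          - \<rho>1 (\<rho>2 a x) (\<alpha>2 b) + m2 (\<alpha>2 a) (\<rho>1 x b) + \<mu>1 (\<mu>2 b x) (\<alpha>2 a)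
          + s2 (1/3) (m2 (\<alpha>2 a) (\<mu>1 x b) + \<mu>1 (\<rho>2 b x) (\<alpha>2 a) - m2 (\<alpha>2 b) (\<mu>1 x a)
              - \<mu>1 (\<rho>2 a x) (\<alpha>2 b) - \<rho>1 (\<alpha>1 x) (m2 a b) + \<rho>1 (\<alpha>1 x) (m2 b a)))"


section \<open>Dual space, dual maps, dual actions\<close>

definition fun_scale :: "'f::field \<Rightarrow> ('b \<Rightarrow> 'f) \<Rightarrow> 'b \<Rightarrow> 'f" where
  "fun_scale c \<xi> = (\<lambda>x. c * \<xi> x)"

definition dual_space :: "('f::field \<Rightarrow> 'a::ab_group_add \<Rightarrow> 'a) \<Rightarrow> ('a \<Rightarrow> 'f) set" where
  "dual_space s = {\<xi>. Vector_Spaces.linear s (*) \<xi>}"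

definition dual_map :: "('a \<Rightarrow> 'b) \<Rightarrow> ('b \<Rightarrow> 'f) \<Rightarrow> 'a \<Rightarrow> 'f" where
  "dual_map T \<xi> = (\<lambda>v. \<xi> (T v))"

definition dual_action :: "('x \<Rightarrow> 'v \<Rightarrow> 'v) \<Rightarrow> 'x \<Rightarrow> ('v \<Rightarrow> 'f::field) \<Rightarrow> 'v \<Rightarrow> 'f" where
  "dual_action \<rho> x \<xi> = (\<lambda>v. - \<xi> (\<rho> x v))"

definition Lmul :: "('v \<Rightarrow> 'v \<Rightarrow> 'v) \<Rightarrow> 'v \<Rightarrow> 'v \<Rightarrow> 'v" where
  "Lmul m x y = m x y"

definition Rmul :: "('v \<Rightarrow> 'v \<Rightarrow> 'v) \<Rightarrow> 'v \<Rightarrow> 'v \<Rightarrow> 'v" where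
  "Rmul m x y = m y x"

text \<open>The canonical map from \<open>A\<close> to its bidual, and its inverse (\<open>A\<close> being finite-dimensional).\<close>

definition to_bidual :: "'a \<Rightarrow> ('a \<Rightarrow> 'f) \<Rightarrow> 'f" where
  "to_bidual x = (\<lambda>\<xi>. \<xi> x)"

definition from_bidual ::
  "('f::field \<Rightarrow> 'a::ab_group_add \<Rightarrow> 'a) \<Rightarrow> (('a \<Rightarrow> 'f) \<Rightarrow> 'f) \<Rightarrow> 'a" where
  "from_bidual s F = (THE x. \<forall>\<xi>\<in>dual_space s. to_bidual x \<xi> = F \<xi>)"

definition Lstar :: "('a \<Rightarrow> 'a \<Rightarrow> 'a) \<Rightarrow> ('a \<Rightarrow> 'a) \<Rightarrow> 'a \<Rightarrow> ('a \<Rightarrow> 'f::field) \<Rightarrow> 'a \<Rightarrow> 'f" where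
  "Lstar m \<alpha> x \<xi> = dual_action (Lmul m) (\<alpha> x) (dual_map (inv \<alpha> \<circ> inv \<alpha>) \<xi>)"

definition Rstar :: "('a \<Rightarrow> 'a \<Rightarrow> 'a) \<Rightarrow> ('a \<Rightarrow> 'a) \<Rightarrow> 'a \<Rightarrow> ('a \<Rightarrow> 'f::field) \<Rightarrow> 'a \<Rightarrow> 'f" where
  "Rstar m \<alpha> x \<xi> = dual_action (Rmul m) (\<alpha> x) (dual_map (inv \<alpha> \<circ> inv \<alpha>) \<xi>)"

text \<open>
  For a product \<open>n\<close> on the dual space, \<open>dual_action (Lmul n)\<close> acts on the bidual; the result is
  transported back to \<open>A\<close>.
\<close>

definition Lstar_dual ::
  "('f::field \<Rightarrow> 'a::ab_group_add \<Rightarrow> 'a) \<Rightarrow> (('a \<Rightarrow> 'f) \<Rightarrow> ('a \<Rightarrow> 'f) \<Rightarrow> 'a \<Rightarrow> 'f) \<Rightarrow> ('a \<Rightarrow> 'a)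
    \<Rightarrow> ('a \<Rightarrow> 'f) \<Rightarrow> 'a \<Rightarrow> 'a" where
  "Lstar_dual s n \<alpha> \<xi> x =
     from_bidual s (dual_action (Lmul n) (dual_map (inv \<alpha>) \<xi>) (to_bidual ((\<alpha> \<circ> \<alpha>) x)))"

definition Rstar_dual ::
  "('f::field \<Rightarrow> 'a::ab_group_add \<Rightarrow> 'a) \<Rightarrow> (('a \<Rightarrow> 'f) \<Rightarrow> ('a \<Rightarrow> 'f) \<Rightarrow> 'a \<Rightarrow> 'f) \<Rightarrow> ('a \<Rightarrow> 'a)
    \<Rightarrow> ('a \<Rightarrow> 'f) \<Rightarrow> 'a \<Rightarrow> 'a" where
  "Rstar_dual s n \<alpha> \<xi> x =
     from_bidual s (dual_action (Rmul n) (dual_map (inv \<alpha>) \<xi>) (to_bidual ((\<alpha> \<circ> \<alpha>) x)))"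


section \<open>The tensor square of a finite-dimensional space\<close>

text \<open>
  For finite-dimensional \<open>A\<close>, the space \<open>A \<otimes> A\<close> is realised as the space of bilinear forms on
  \<open>A* \<times> A*\<close>, where \<open>u \<otimes> v\<close> is the form \<open>(\<xi>, \<eta>) \<mapsto> \<xi>(u) \<eta>(v)\<close>; thus \<open>T \<xi> \<eta>\<close> is the pairing of
  \<open>\<xi> \<otimes> \<eta>\<close> with \<open>T\<close>. Forms vanish by convention off the dual space, so that equality of tensors
  is equality of functions.
\<close>

definition tensor_scale :: "'f::field \<Rightarrow> ('b \<Rightarrow> 'c \<Rightarrow> 'f) \<Rightarrow> 'b \<Rightarrow> 'c \<Rightarrow> 'f" where
  "tensor_scale c T = (\<lambda>\<xi> \<eta>. c * T \<xi> \<eta>)"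

definition tensor_square ::
  "('f::field \<Rightarrow> 'a::ab_group_add \<Rightarrow> 'a) \<Rightarrow> (('a \<Rightarrow> 'f) \<Rightarrow> ('a \<Rightarrow> 'f) \<Rightarrow> 'f) set" where
  "tensor_square s =
     {T. bilinear_map_on fun_scale (dual_space s) fun_scale (dual_space s) (*) UNIV T \<and>
         (\<forall>\<xi> \<eta>. \<xi> \<notin> dual_space s \<or> \<eta> \<notin> dual_space s \<longrightarrow> T \<xi> \<eta> = 0)}"

definition pure_tensor ::
  "('f::field \<Rightarrow> 'a::ab_group_add \<Rightarrow> 'a) \<Rightarrow> 'a \<Rightarrow> 'a \<Rightarrow> ('a \<Rightarrow> 'f) \<Rightarrow> ('a \<Rightarrow> 'f) \<Rightarrow> 'f" where
  "pure_tensor s u v =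
     (\<lambda>\<xi> \<eta>. if \<xi> \<in> dual_space s \<and> \<eta> \<in> dual_space s then \<xi> u * \<eta> v else 0)"

text \<open>The map \<open>f \<otimes> g\<close> and the flip \<open>\<tau>\<close>; see the lemmas on pure tensors below.\<close>

definition tensor_map ::
  "('f::field \<Rightarrow> 'a::ab_group_add \<Rightarrow> 'a) \<Rightarrow> ('a \<Rightarrow> 'a) \<Rightarrow> ('a \<Rightarrow> 'a)
    \<Rightarrow> (('a \<Rightarrow> 'f) \<Rightarrow> ('a \<Rightarrow> 'f) \<Rightarrow> 'f) \<Rightarrow> ('a \<Rightarrow> 'f) \<Rightarrow> ('a \<Rightarrow> 'f) \<Rightarrow> 'f" where
  "tensor_map s f g T =
     (\<lambda>\<xi> \<eta>. if \<xi> \<in> dual_space s \<and> \<eta> \<in> dual_space s then T (dual_map f \<xi>) (dual_map g \<eta>) else 0)"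

definition tensor_flip :: "('b \<Rightarrow> 'b \<Rightarrow> 'f) \<Rightarrow> 'b \<Rightarrow> 'b \<Rightarrow> 'f" where
  "tensor_flip T = (\<lambda>\<xi> \<eta>. T \<eta> \<xi>)"

text \<open>
  The product on the dual space given by the dual of \<open>\<Delta> : A \<rightarrow> A \<otimes> A\<close>: its value at
  \<open>\<xi> \<otimes> \<eta>\<close> is the functional sending \<open>x\<close> to the pairing of \<open>\<xi> \<otimes> \<eta>\<close> with \<open>\<Delta> x\<close>.
\<close>

definition coproduct_dual ::
  "('a \<Rightarrow> ('a \<Rightarrow> 'f) \<Rightarrow> ('a \<Rightarrow> 'f) \<Rightarrow> 'f) \<Rightarrow> ('a \<Rightarrow> 'f) \<Rightarrow> ('a \<Rightarrow> 'f) \<Rightarrow> 'a \<Rightarrow> 'f" where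
  "coproduct_dual \<Delta> \<xi> \<eta> = (\<lambda>x. \<Delta> x \<xi> \<eta>)"


subsection \<open>Agreement with the usual description\<close>

lemma dual_map_in_dual_space:
  assumes "Vector_Spaces.linear s s f" and "\<xi> \<in> dual_space s"
  shows "dual_map f \<xi> \<in> dual_space s"
  using Vector_Spaces.linear_compose[of s s f "(*)" \<xi>] assms
  by (simp add: dual_space_def dual_map_def o_def)

lemma tensor_map_pure_tensor:
  assumes "Vector_Spaces.linear s s f" and "Vector_Spaces.linear s s g"
  shows "tensor_map s f g (pure_tensor s u v) = pure_tensor s (f u) (g v)"
  using dual_map_in_dual_space[OF assms(1)] dual_map_in_dual_space[OF assms(2)]
  by (auto simp: tensor_map_def pure_tensor_def fun_eq_iff) (simp_all add: dual_map_def)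

lemma tensor_flip_pure_tensor: "tensor_flip (pure_tensor s u v) = pure_tensor s v u"
  by (auto simp: tensor_flip_def pure_tensor_def fun_eq_iff)

lemma dual_separates:
  fixes s :: "'f::field \<Rightarrow> 'a::ab_group_add \<Rightarrow> 'a"
  assumes "vector_space s" and "\<And>\<xi>. \<xi> \<in> dual_space s \<Longrightarrow> \<xi> x = \<xi> y"
  shows "x = y"
proof (rule ccontr)
  assume "x \<noteq> y"
  interpret vector_space s by fact
  interpret P: vector_space_pair s "(*) :: 'f \<Rightarrow> 'f \<Rightarrow> 'f"
    by unfold_locales (simp_all add: algebra_simps)
  have "independent {x - y}"
    using \<open>x \<noteq> y\<close> by (simp add: dependent_single)
  from P.linear_independent_extend[OF this, of "\<lambda>_. 1"]
  obtain g where g: "Vector_Spaces.linear s (*) g" "g (x - y) = 1" by auto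
  interpret g: Vector_Spaces.linear s "(*)" g by fact
  from assms(2)[of g] g show False by (simp add: dual_space_def g.diff)
qed

lemma from_bidual_to_bidual:
  assumes "vector_space s"
  shows "from_bidual s (to_bidual x) = x"
  unfolding from_bidual_def
  by (rule the_equality) (auto simp: to_bidual_def intro: dual_separates[OF assms])

text \<open>Dual bases, and the two consequences of finite dimension relied on above.\<close>

lemma dual_basis:
  fixes s :: "'f::field \<Rightarrow> 'a::ab_group_add \<Rightarrow> 'a"
  assumes "fin_dim_space s UNIV"
  obtains B e where "finite B" and "\<And>b. e b \<in> dual_space s"
    and "\<And>\<xi>. \<xi> \<in> dual_space s \<Longrightarrow> \<xi> = (\<Sum>b\<in>B. fun_scale (\<xi> b) (e b))"
proof -
  from assms obtain C where C: "finite C" "module.span s C = UNIV" and vs: "vector_space s"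
    by (auto simp: fin_dim_space_def)
  interpret vector_space s by fact
  interpret P: vector_space_pair s "(*) :: 'f \<Rightarrow> 'f \<Rightarrow> 'f"
    by unfold_locales (simp_all add: algebra_simps)
  obtain B where B: "B \<subseteq> C" "independent B" "span B = UNIV"
    using maximal_independent_subset[of C] C(2)
    by (metis span_mono span_span top.extremum_uniqueI)
  have fin: "finite B" using B(1) C(1) by (rule finite_subset)
  define e where "e b = (\<lambda>x. representation B x b)" for b
  have e: "e b \<in> dual_space s" for b
    unfolding dual_space_def mem_Collect_eq e_def
    by (simp add: Vector_Spaces.linear_iff vs P.vs2.vector_space_axioms B representation_add
        representation_scale)
  have "\<xi> = (\<Sum>b\<in>B. fun_scale (\<xi> b) (e b))" if "\<xi> \<in> dual_space s" for \<xi>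
  proof
    fix x
    interpret xi: Vector_Spaces.linear s "(*)" \<xi> using that by (simp add: dual_space_def)
    have "\<xi> x = \<xi> (\<Sum>b\<in>B. s (representation B x b) b)"
      using sum_representation_eq[OF B(2) _ fin subset_refl, of x] B(3) by simp
    also have "\<dots> = (\<Sum>b\<in>B. \<xi> b * e b x)"
      by (simp add: xi.sum xi.scale e_def mult.commute)
    also have "\<dots> = (\<Sum>b\<in>B. fun_scale (\<xi> b) (e b)) x"
      using fin by (induction B rule: finite_induct) (simp_all add: fun_scale_def)
    finally show "\<xi> x = (\<Sum>b\<in>B. fun_scale (\<xi> b) (e b)) x" .
  qed
  with fin e show thesis by (rule that)
qed

lemma linear_map_on_sum:
  assumes "linear_map_on t V r W f" and "module.subspace t V" and "module t" and "module r"
    and "finite B" and "\<And>b. b \<in> B \<Longrightarrow> e b \<in> V"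
  shows "(\<Sum>b\<in>B. t (c b) (e b)) \<in> V \<and> f (\<Sum>b\<in>B. t (c b) (e b)) = (\<Sum>b\<in>B. r (c b) (f (e b)))"
  using assms(5,6)
proof (induction B rule: finite_induct)
  case empty
  interpret t: module t by fact
  interpret r: module r by fact
  have z: "0 \<in> V" using assms(2) by (rule t.subspace_0)
  with assms(1) have "f (t 0 0) = r 0 (f 0)" unfolding linear_map_on_def by blast
  with z show ?case by simp
next
  case (insert a B)
  interpret t: module t by fact
  have "t (c a) (e a) \<in> V" using assms(2) insert.prems by (auto intro: t.subspace_scale)
  moreover have "(\<Sum>b\<in>B. t (c b) (e b)) \<in> V" using insert by auto
  ultimately show ?case
    using assms(1,2) insert by (auto simp: linear_map_on_def intro: t.subspace_add)
qed

lemma module_fun_scale: "module (fun_scale :: 'f::field \<Rightarrow> ('b \<Rightarrow> 'f) \<Rightarrow> _)"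
  by unfold_locales (auto simp: fun_scale_def fun_eq_iff algebra_simps)

lemma module_tensor_scale: "module (tensor_scale :: 'f::field \<Rightarrow> ('b \<Rightarrow> 'c \<Rightarrow> 'f) \<Rightarrow> _)"
  by unfold_locales (auto simp: tensor_scale_def fun_eq_iff algebra_simps)

lemma module_mult: "module ((*) :: 'f::field \<Rightarrow> 'f \<Rightarrow> 'f)"
  by unfold_locales (auto simp: algebra_simps)

lemma subspace_dual_space:
  fixes s :: "'f::field \<Rightarrow> 'a::ab_group_add \<Rightarrow> 'a"
  assumes "vector_space s"
  shows "module.subspace fun_scale (dual_space s)"
proof -
  interpret vector_space s by fact
  interpret P: vector_space_pair s "(*) :: 'f \<Rightarrow> 'f \<Rightarrow> 'f"
    by unfold_locales (simp_all add: algebra_simps)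
  have "(\<lambda>x. 0) = (0 :: 'a \<Rightarrow> 'f)"
    and "\<And>f g :: 'a \<Rightarrow> 'f. (\<lambda>x. f x + g x) = f + g" by auto
  then show ?thesis
    using P.linear_zero P.linear_compose_add P.linear_compose_scale_right
    by (auto simp: module.subspace_def[OF module_fun_scale] dual_space_def fun_scale_def)
qed

lemma to_bidual_from_bidual:
  fixes s :: "'f::field \<Rightarrow> 'a::ab_group_add \<Rightarrow> 'a"
  assumes "fin_dim_space s UNIV" and "linear_map_on fun_scale (dual_space s) (*) UNIV F"
    and "\<xi> \<in> dual_space s"
  shows "to_bidual (from_bidual s F) \<xi> = F \<xi>"
proof -
  have vs: "vector_space s" using assms(1) by (simp add: fin_dim_space_def)
  obtain B and e :: "'a \<Rightarrow> 'a \<Rightarrow> 'f" where B: "finite B" "\<And>b. e b \<in> dual_space s"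
    and exp: "\<And>\<xi>. \<xi> \<in> dual_space s \<Longrightarrow> \<xi> = (\<Sum>b\<in>B. fun_scale (\<xi> b) (e b))"
    using dual_basis[OF assms(1)] by blast
  define x where "x = (\<Sum>b\<in>B. s (F (e b)) b)"
  have x: "to_bidual x \<eta> = F \<eta>" if eta: "\<eta> \<in> dual_space s" for \<eta>
  proof -
    interpret eta: Vector_Spaces.linear s "(*)" \<eta> using eta by (simp add: dual_space_def)
    have "F \<eta> = F (\<Sum>b\<in>B. fun_scale (\<eta> b) (e b))" using exp[OF eta] by simp
    also have "\<dots> = (\<Sum>b\<in>B. \<eta> b * F (e b))"
      using linear_map_on_sum[OF assms(2) subspace_dual_space[OF vs] module_fun_scale module_mult
          B(1), of e \<eta>] B(2) by simp
    also have "\<dots> = \<eta> x" by (simp add: x_def eta.sum eta.scale mult.commute)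
    finally show ?thesis by (simp add: to_bidual_def)
  qed
  have "from_bidual s F = x"
    unfolding from_bidual_def
  proof (rule the_equality)
    fix y assume y: "\<forall>\<xi>\<in>dual_space s. to_bidual y \<xi> = F \<xi>"
    show "y = x"
      by (rule dual_separates[OF vs]) (use x y in \<open>simp add: to_bidual_def\<close>)
  qed (use x in blast)
  with x assms(3) show ?thesis by simp
qed

lemma tensor_square_spanned:
  fixes s :: "'f::field \<Rightarrow> 'a::ab_group_add \<Rightarrow> 'a"
  assumes "fin_dim_space s UNIV" and "T \<in> tensor_square s"
  shows "\<exists>B c. finite B \<and>
           T = (\<Sum>b\<in>B. \<Sum>b'\<in>B. tensor_scale (c b b') (pure_tensor s b b'))"
proof -
  have vs: "vector_space s" using assms(1) by (simp add: fin_dim_space_def)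
  obtain B and e :: "'a \<Rightarrow> 'a \<Rightarrow> 'f" where B: "finite B" "\<And>b. e b \<in> dual_space s"
    and exp: "\<And>\<xi>. \<xi> \<in> dual_space s \<Longrightarrow> \<xi> = (\<Sum>b\<in>B. fun_scale (\<xi> b) (e b))"
    using dual_basis[OF assms(1)] by blast
  note lin = linear_map_on_sum[OF _ subspace_dual_space[OF vs] module_fun_scale module_mult B(1)]
  have bil: "bilinear_map_on fun_scale (dual_space s) fun_scale (dual_space s) (*) UNIV T"
    and off: "\<And>\<xi> \<eta>. \<xi> \<notin> dual_space s \<or> \<eta> \<notin> dual_space s \<Longrightarrow> T \<xi> \<eta> = 0"
    using assms(2) by (auto simp: tensor_square_def)
  have app: "(\<Sum>b\<in>B. h b) \<xi> = (\<Sum>b\<in>B. h b \<xi>)" for h :: "'a \<Rightarrow> 'c \<Rightarrow> 'd::comm_monoid_add" and \<xi>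
    using B(1) by (induction B rule: finite_induct) simp_all
  have "T \<xi> \<eta> = (\<Sum>b\<in>B. \<Sum>b'\<in>B. tensor_scale (T (e b) (e b')) (pure_tensor s b b')) \<xi> \<eta>" for \<xi> \<eta>
  proof (cases "\<xi> \<in> dual_space s \<and> \<eta> \<in> dual_space s")
    case True
    have "T \<xi> \<eta> = T (\<Sum>b\<in>B. fun_scale (\<xi> b) (e b)) \<eta>" using exp[of \<xi>] True by simp
    also have "\<dots> = (\<Sum>b\<in>B. \<xi> b * T (e b) \<eta>)"
      using lin[where f = "\<lambda>\<xi>. T \<xi> \<eta>" and W = UNIV and e = e and c = \<xi>] bil B(2) True
      by (simp add: bilinear_map_on_def)
    also have "\<dots> = (\<Sum>b\<in>B. \<xi> b * T (e b) (\<Sum>b'\<in>B. fun_scale (\<eta> b') (e b')))"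
      using exp[of \<eta>] True by simp
    also have "\<dots> = (\<Sum>b\<in>B. \<xi> b * (\<Sum>b'\<in>B. \<eta> b' * T (e b) (e b')))"
    proof (rule sum.cong[OF refl])
      fix b
      show "\<xi> b * T (e b) (\<Sum>b'\<in>B. fun_scale (\<eta> b') (e b'))
          = \<xi> b * (\<Sum>b'\<in>B. \<eta> b' * T (e b) (e b'))"
        using lin[where f = "T (e b)" and W = UNIV and e = e and c = \<eta>] bil B(2)
        by (simp add: bilinear_map_on_def)
    qed
    finally show ?thesis
      using True by (simp add: app tensor_scale_def pure_tensor_def sum_distrib_left ac_simps)
  next
    case False
    then show ?thesis by (auto simp: off app tensor_scale_def pure_tensor_def)
  qed
  then have "T = (\<Sum>b\<in>B. \<Sum>b'\<in>B. tensor_scale (T (e b) (e b')) (pure_tensor s b b'))"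
    by (intro ext)
  with B(1) show ?thesis by (intro exI[of _ B] exI[of _ "\<lambda>b b'. T (e b) (e b')"]) simp
qed

end

theory Submission
  imports Defs
begin

text \<open>
  The proof takes place in the double \<open>E = A \<times> A*\<close>, with the product that restricts to the two given
  products and whose mixed products are formed from the four actions, and with the twist
  \<open>\<alpha> \<times> \<alpha>\<^sub>A\<^sub>*\<close>. A matched pair is one for which the double is again an admissible Hom-Poisson
  algebra. It carries the canonical pairing \<open>\<langle>(x, \<xi>), (y, \<eta>)\<rangle> = \<xi>(y) + \<eta>(x)\<close>, and the starred
  dual actions are made so that \<open>\<langle>X Y, \<alpha> Z\<rangle>\<close> is invariant under cyclic rotation of \<open>X, Y, Z\<close>
  (\<open>pairing_dmul_cyclic\<close>). The twist respects both the product and the pairing.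

  Put \<open>q(X, Y, Z, W) = \<langle>X Y, Z W\<rangle>\<close>. Rotating and removing twists gives
  \<open>\<langle>(X Y) \<alpha>Z, \<alpha>\<^sup>2 W\<rangle> = q(X, Y, Z, W)\<close> and \<open>\<langle>\<alpha>X (Y Z), \<alpha>\<^sup>2 W\<rangle> = q(Y, Z, W, X)\<close>. The pairing being
  nondegenerate, the admissible identity for \<open>X, Y, Z\<close> says that a certain linear relation
  \<open>J(X, Y, Z | W)\<close> between values of the single function \<open>q\<close> holds for all \<open>W\<close>. The algebraic heart
  is \<open>cyclic_identity_rotate\<close>: because \<open>q(X, Y, Z, W) = q(Z, W, X, Y)\<close>, the six relations obtained by
  permuting \<open>X, Y, Z\<close> with \<open>W\<close> in the last place imply those with \<open>X\<close>, \<open>Y\<close> or \<open>Z\<close> in the last place.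

  Now sort the relations by the number of arguments from \<open>A\<close>. With three arguments in \<open>A\<close> and one in
  \<open>A*\<close>, the relation with the covector last is the identity of \<open>A\<close>, and its rotations say that
  \<open>A*\<close> is a representation of \<open>A\<close>; with the roles exchanged, \<open>A\<close> is a representation of \<open>A*\<close>.
  With two arguments of each kind, the relations with a covector last are the first three
  compatibility conditions of a matched pair, and those with a vector last are the other three,
  which therefore follow by rotation. Finally, for \<open>x, y \<in> A\<close> and \<open>\<xi>, \<eta> \<in> A*\<close> the values of \<open>q\<close> are
  pairings of \<open>\<xi>, \<eta>\<close> with \<open>\<Delta>(x y)\<close> and with images of \<open>\<Delta> x\<close> and \<open>\<Delta> y\<close> under tensor products of
  maps (\<open>quad_values\<close>), so that the three relations with a covector last are, value by value, the
  three tensor equations.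
\<close>


section \<open>Rotating the admissible identity\<close>

text \<open>
  This is what becomes of the admissible identity for \<open>X, Y, Z\<close> when it is paired with \<open>W\<close>
  under a rotation-invariant form: \<open>f X Y Z W\<close> stands for the pairing of \<open>X Y\<close> with \<open>Z W\<close>.
\<close>

definition cyclic_identity ::
  "('e \<Rightarrow> 'e \<Rightarrow> 'e \<Rightarrow> 'e \<Rightarrow> 'f::field) \<Rightarrow> 'e \<Rightarrow> 'e \<Rightarrow> 'e \<Rightarrow> 'e \<Rightarrow> bool" where
  "cyclic_identity f X Y Z W \<longleftrightarrow>
     f X Y Z W = f Y Z W X - 1/3 * (- f Z Y W X + f X Y W Z + f X Z W Y - f Z X W Y)"

text \<open>
  The symmetry leaves twelve independent values of \<open>f\<close> on the permutations of four arguments. In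
  terms of these, each relation with another argument in the last place is a combination of the six
  given ones with coefficients \<open>0\<close>, \<open>\<plusminus>1\<close> and \<open>\<plusminus>1/3\<close>, so the statement holds in every
  characteristic other than three.
\<close>

lemma cyclic_identity_rotate:
  fixes f :: "'e \<Rightarrow> 'e \<Rightarrow> 'e \<Rightarrow> 'e \<Rightarrow> 'f::field"
  assumes "(3::'f) \<noteq> 0"
    and sym: "\<And>X Y Z W. f X Y Z W = f Z W X Y"
    and XYZ: "cyclic_identity f X Y Z W" and XZY: "cyclic_identity f X Z Y W"
    and YXZ: "cyclic_identity f Y X Z W" and YZX: "cyclic_identity f Y Z X W"
    and ZXY: "cyclic_identity f Z X Y W" and ZYX: "cyclic_identity f Z Y X W"
  shows "cyclic_identity f W X Y Z" and "cyclic_identity f X W Y Z" and "cyclic_identity f X Y W Z"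
proof -
  \<comment> \<open>three times the defect of the identity, so that all coefficients are integers\<close>
  define d where
    "d X Y Z W = 3 * f X Y Z W - 3 * f Y Z W X - f Z Y W X + f X Y W Z + f X Z W Y - f Z X W Y"
    for X Y Z W
  have d: "cyclic_identity f X Y Z W \<longleftrightarrow> d X Y Z W = 0" for X Y Z W
  proof -
    have "d X Y Z W
        = 3 * (f X Y Z W - (f Y Z W X - 1/3 * (- f Z Y W X + f X Y W Z + f X Z W Y - f Z X W Y)))"
      using assms(1) by (simp add: d_def algebra_simps)
    then show ?thesis
      unfolding cyclic_identity_def using assms(1)
      by (simp only: mult_eq_0_iff right_minus_eq simp_thms)
  qed
  have zero: "d X Y Z W = 0" "d X Z Y W = 0" "d Y X Z W = 0" "d Y Z X W = 0"
    "d Z X Y W = 0" "d Z Y X W = 0"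
    using XYZ XZY YXZ YZX ZXY ZYX by (simp_all add: d)
  \<comment> \<open>one representative of each pair of values identified by the symmetry\<close>
  note syms = sym[of Y Z W X] sym[of Z Y W X] sym[of X Z W Y] sym[of Z X W Y] sym[of X Y W Z]
    sym[of Y X W Z] sym[of Z W X Y] sym[of Z W Y X] sym[of Y W X Z] sym[of Y W Z X]
    sym[of X W Y Z] sym[of X W Z Y]
  have "3 * d W X Y Z = - 3 * d X Y Z W - d Y X Z W - d Z X Y W"
    unfolding d_def syms by (simp add: algebra_simps)
  then show "cyclic_identity f W X Y Z" using assms(1) by (simp add: d zero)
  have "3 * d X W Y Z = d X Y Z W - d Y X Z W + 3 * d Y Z X W - d Z X Y W + d Z Y X W"
    unfolding d_def syms by (simp add: algebra_simps)
  then show "cyclic_identity f X W Y Z" using assms(1) by (simp add: d zero)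
  have "3 * d X Y W Z = d X Y Z W - 3 * d Z X Y W + d Z Y X W"
    unfolding d_def syms by (simp add: algebra_simps)
  then show "cyclic_identity f X Y W Z" using assms(1) by (simp add: d zero)
qed

section \<open>An algebra and its dual acting on one another\<close>

locale hom_poisson_dual_double =
  fixes scale :: "'f::field \<Rightarrow> 'a::ab_group_add \<Rightarrow> 'a"
    and m :: "'a \<Rightarrow> 'a \<Rightarrow> 'a"
    and \<alpha> :: "'a \<Rightarrow> 'a"
    and \<Delta> :: "'a \<Rightarrow> ('a \<Rightarrow> 'f) \<Rightarrow> ('a \<Rightarrow> 'f) \<Rightarrow> 'f"
  assumes three: "(3::'f) \<noteq> 0"
    and algebra: "regular_admissible_hom_poisson scale UNIV m \<alpha>"
    and coproduct: "linear_map_on scale UNIV tensor_scale (tensor_square scale) \<Delta>"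
    and dual_algebra: "admissible_hom_poisson fun_scale (dual_space scale) (coproduct_dual \<Delta>)
      (dual_map (inv \<alpha>))"
begin

abbreviation \<beta> :: "'a \<Rightarrow> 'a" where "\<beta> \<equiv> inv \<alpha>"
abbreviation D :: "('a \<Rightarrow> 'f) set" where "D \<equiv> dual_space scale"
abbreviation n :: "('a \<Rightarrow> 'f) \<Rightarrow> ('a \<Rightarrow> 'f) \<Rightarrow> 'a \<Rightarrow> 'f" where "n \<equiv> coproduct_dual \<Delta>"
abbreviation \<gamma> :: "('a \<Rightarrow> 'f) \<Rightarrow> 'a \<Rightarrow> 'f" where "\<gamma> \<equiv> dual_map \<beta>"

definition \<rho>1 :: "'a \<Rightarrow> ('a \<Rightarrow> 'f) \<Rightarrow> 'a \<Rightarrow> 'f" where "\<rho>1 = (\<lambda>x \<xi>. - Rstar m \<alpha> x \<xi>)"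
definition \<mu>1 :: "'a \<Rightarrow> ('a \<Rightarrow> 'f) \<Rightarrow> 'a \<Rightarrow> 'f" where "\<mu>1 = (\<lambda>x \<xi>. - Lstar m \<alpha> x \<xi>)"
definition \<rho>2 :: "('a \<Rightarrow> 'f) \<Rightarrow> 'a \<Rightarrow> 'a" where "\<rho>2 = (\<lambda>\<xi> x. - Rstar_dual scale n \<alpha> \<xi> x)"
definition \<mu>2 :: "('a \<Rightarrow> 'f) \<Rightarrow> 'a \<Rightarrow> 'a" where "\<mu>2 = (\<lambda>\<xi> x. - Lstar_dual scale n \<alpha> \<xi> x)"

lemma fin_dim: "fin_dim_space scale UNIV" and fin_dim_dual: "fin_dim_space fun_scale D"
  using algebra dual_algebra
  by (simp_all add: regular_admissible_hom_poisson_def admissible_hom_poisson_def)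

lemma vector_space_scale: "vector_space scale"
  using fin_dim by (simp add: fin_dim_space_def)

sublocale vector_space scale by (rule vector_space_scale)

sublocale F: vector_space "fun_scale :: 'f \<Rightarrow> ('a \<Rightarrow> 'f) \<Rightarrow> 'a \<Rightarrow> 'f"
  using fin_dim_dual by (simp add: fin_dim_space_def)

lemma \<alpha>_\<beta> [simp]: "\<alpha> (\<beta> x) = x" and \<beta>_\<alpha> [simp]: "\<beta> (\<alpha> x) = x"
  using algebra
  by (simp_all add: regular_admissible_hom_poisson_def bij_is_surj surj_f_inv_f bij_is_inj)

lemma \<alpha>_add: "\<alpha> (x + y) = \<alpha> x + \<alpha> y" and \<alpha>_scale: "\<alpha> (scale c x) = scale c (\<alpha> x)"
  and \<alpha>_mult: "\<alpha> (m x y) = m (\<alpha> x) (\<alpha> y)"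
  using algebra
  by (simp_all add: regular_admissible_hom_poisson_def admissible_hom_poisson_def linear_map_on_def)

lemma \<beta>_add: "\<beta> (x + y) = \<beta> x + \<beta> y"
  by (metis \<alpha>_\<beta> \<beta>_\<alpha> \<alpha>_add)

lemma \<beta>_scale: "\<beta> (scale c x) = scale c (\<beta> x)"
  by (metis \<alpha>_\<beta> \<beta>_\<alpha> \<alpha>_scale)

lemma \<beta>_mult: "\<beta> (m x y) = m (\<beta> x) (\<beta> y)"
  by (metis \<alpha>_\<beta> \<beta>_\<alpha> \<alpha>_mult)

lemma mult_linear:
  "m (x + y) z = m x z + m y z" "m z (x + y) = m z x + m z y"
  "m (scale c x) z = scale c (m x z)" "m z (scale c x) = scale c (m z x)"
  using algebra
  by (simp_all add: regular_admissible_hom_poisson_def admissible_hom_poisson_def linear_map_on_def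
      bilinear_map_on_def)

lemma mult_zero: "m 0 x = 0" "m x 0 = 0"
  using mult_linear(1)[of 0 0 x] mult_linear(2)[of x 0 0] by simp_all

lemma mult_admissible:
  "m (m x y) (\<alpha> z) = m (\<alpha> x) (m y z)
    - scale (1/3) (- m (\<alpha> x) (m z y) + m (\<alpha> z) (m x y) + m (\<alpha> y) (m x z) - m (\<alpha> y) (m z x))"
  using algebra
  by (simp add: regular_admissible_hom_poisson_def admissible_hom_poisson_def)

lemma dual_iff: "\<xi> \<in> D \<longleftrightarrow> (\<forall>x y. \<xi> (x + y) = \<xi> x + \<xi> y) \<and> (\<forall>c x. \<xi> (scale c x) = c * \<xi> x)"
proof -
  interpret P: vector_space_pair scale "(*) :: 'f \<Rightarrow> 'f \<Rightarrow> 'f"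
    by unfold_locales (simp_all add: algebra_simps)
  show ?thesis
    by (auto simp: dual_space_def Vector_Spaces.linear_iff vector_space_scale
        P.vs2.vector_space_axioms)
qed

lemma dualD:
  assumes "\<xi> \<in> D"
  shows "\<xi> (x + y) = \<xi> x + \<xi> y" "\<xi> (scale c x) = c * \<xi> x" "\<xi> 0 = 0" "\<xi> (- x) = - \<xi> x"
    "\<xi> (x - y) = \<xi> x - \<xi> y"
proof -
  show add: "\<xi> (x + y) = \<xi> x + \<xi> y" for x y using assms by (simp add: dual_iff)
  show scale: "\<xi> (scale c x) = c * \<xi> x" for c x using assms by (simp add: dual_iff)
  show zero: "\<xi> 0 = 0" using scale[of 0 0] by simp
  show neg: "\<xi> (- x) = - \<xi> x" for x
    using add[of x "- x"] zero by (simp add: eq_neg_iff_add_eq_0 add.commute)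
  show "\<xi> (x - y) = \<xi> x - \<xi> y" using add[of x "- y"] neg[of y] by simp
qed

lemma dual_closed:
  "0 \<in> D" "\<xi> \<in> D \<Longrightarrow> \<eta> \<in> D \<Longrightarrow> \<xi> + \<eta> \<in> D" "\<xi> \<in> D \<Longrightarrow> fun_scale c \<xi> \<in> D"
  by (auto simp: dual_iff fun_scale_def algebra_simps)

lemma dual_comp:
  assumes "\<xi> \<in> D"
  shows "(\<lambda>v. \<xi> (m v x)) \<in> D" "(\<lambda>v. \<xi> (m x v)) \<in> D" "(\<lambda>v. \<xi> (\<alpha> v)) \<in> D" "(\<lambda>v. \<xi> (\<beta> v)) \<in> D"
  using assms by (simp_all add: dual_iff mult_linear \<alpha>_add \<alpha>_scale \<beta>_add \<beta>_scale)

lemma \<gamma>_apply: "\<gamma> \<xi> x = \<xi> (\<beta> x)"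
  by (simp add: dual_map_def)

lemma \<gamma>_closed: "\<xi> \<in> D \<Longrightarrow> \<gamma> \<xi> \<in> D"
  using dual_comp(4) by (simp add: dual_map_def)

lemma \<Delta>_linear:
  "\<Delta> (x + y) \<xi> \<eta> = \<Delta> x \<xi> \<eta> + \<Delta> y \<xi> \<eta>" "\<Delta> (scale c x) \<xi> \<eta> = c * \<Delta> x \<xi> \<eta>"
  using coproduct by (simp_all add: linear_map_on_def tensor_scale_def)

lemma \<Delta>_tensor: "\<Delta> x \<in> tensor_square scale"
  using coproduct by (simp add: linear_map_on_def)

lemma \<Delta>_bilinear:
  assumes "\<xi> \<in> D" "\<eta> \<in> D" "\<zeta> \<in> D"
  shows "\<Delta> x (\<xi> + \<eta>) \<zeta> = \<Delta> x \<xi> \<zeta> + \<Delta> x \<eta> \<zeta>" "\<Delta> x \<zeta> (\<xi> + \<eta>) = \<Delta> x \<zeta> \<xi> + \<Delta> x \<zeta> \<eta>"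
   "\<Delta> x (fun_scale c \<xi>) \<zeta> = c * \<Delta> x \<xi> \<zeta>" "\<Delta> x \<zeta> (fun_scale c \<xi>) = c * \<Delta> x \<zeta> \<xi>"
  using \<Delta>_tensor[of x] assms
  by (simp_all add: tensor_square_def bilinear_map_on_def linear_map_on_def)

lemma \<Delta>_zero:
  assumes "\<xi> \<in> D" shows "\<Delta> x 0 \<xi> = 0" "\<Delta> x \<xi> 0 = 0"
  using \<Delta>_bilinear(3,4)[OF dual_closed(1) dual_closed(1) assms, of x 0]
  by (simp_all add: fun_scale_def flip: zero_fun_def)

lemma n_apply: "n \<xi> \<eta> x = \<Delta> x \<xi> \<eta>"
  by (simp add: coproduct_dual_def)

lemma n_closed: "\<xi> \<in> D \<Longrightarrow> \<eta> \<in> D \<Longrightarrow> n \<xi> \<eta> \<in> D"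
  using dual_algebra by (simp add: admissible_hom_poisson_def bilinear_map_on_def linear_map_on_def)

lemma n_admissible:
  assumes "\<xi> \<in> D" "\<eta> \<in> D" "\<zeta> \<in> D"
  shows "n (n \<xi> \<eta>) (\<gamma> \<zeta>) = n (\<gamma> \<xi>) (n \<eta> \<zeta>)
    - fun_scale (1/3) (- n (\<gamma> \<xi>) (n \<zeta> \<eta>) + n (\<gamma> \<zeta>) (n \<xi> \<eta>)
        + n (\<gamma> \<eta>) (n \<xi> \<zeta>) - n (\<gamma> \<eta>) (n \<zeta> \<xi>))"
  using dual_algebra assms by (simp add: admissible_hom_poisson_def)

lemma n_\<gamma>: "\<xi> \<in> D \<Longrightarrow> \<eta> \<in> D \<Longrightarrow> \<gamma> (n \<xi> \<eta>) = n (\<gamma> \<xi>) (\<gamma> \<eta>)"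
  using dual_algebra by (simp add: admissible_hom_poisson_def)

lemma \<Delta>_\<beta>: "\<xi> \<in> D \<Longrightarrow> \<eta> \<in> D \<Longrightarrow> \<Delta> x (\<gamma> \<xi>) (\<gamma> \<eta>) = \<Delta> (\<beta> x) \<xi> \<eta>"
  using fun_cong[OF n_\<gamma>, of \<xi> \<eta> x] by (simp add: n_apply \<gamma>_apply)

text \<open>
  The sign in the definition of the contragredient cancels against the sign of the actions in the
  theorem, and \<open>\<alpha>\<^sup>-\<^sup>2\<close> moves through the product, so that both actions are plain transposes of
  multiplications with twisted arguments.
\<close>

lemma \<rho>1_apply: "\<rho>1 x \<xi> v = \<xi> (m (\<beta> (\<beta> v)) (\<beta> x))"
  and \<mu>1_apply: "\<mu>1 x \<xi> v = \<xi> (m (\<beta> x) (\<beta> (\<beta> v)))"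
  by (simp_all add: \<rho>1_def \<mu>1_def Rstar_def Lstar_def dual_action_def dual_map_def Rmul_def
      Lmul_def \<beta>_mult)

lemma action1_closed: "\<xi> \<in> D \<Longrightarrow> \<rho>1 x \<xi> \<in> D" "\<xi> \<in> D \<Longrightarrow> \<mu>1 x \<xi> \<in> D"
  by (simp_all add: dual_iff \<rho>1_apply \<mu>1_apply \<beta>_add \<beta>_scale mult_linear)

text \<open>
  The actions of \<open>A*\<close> on \<open>A\<close> are only known through their pairings with functionals: these lemmas
  remove the identification of \<open>A\<close> with its bidual.
\<close>

lemma \<rho>2_pairing: "\<xi> \<in> D \<Longrightarrow> \<eta> \<in> D \<Longrightarrow> \<eta> (\<rho>2 \<xi> x) = \<Delta> (\<alpha> (\<alpha> x)) \<eta> (\<gamma> \<xi>)"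
  and \<mu>2_pairing: "\<xi> \<in> D \<Longrightarrow> \<eta> \<in> D \<Longrightarrow> \<eta> (\<mu>2 \<xi> x) = \<Delta> (\<alpha> (\<alpha> x)) (\<gamma> \<xi>) \<eta>"
proof -
  assume \<xi>: "\<xi> \<in> D" and \<eta>: "\<eta> \<in> D"
  have "linear_map_on fun_scale D (*) UNIV
      (dual_action (Rmul n) (\<gamma> \<xi>) (to_bidual ((\<alpha> \<circ> \<alpha>) x)))"
    using \<gamma>_closed[OF \<xi>]
    by (simp add: linear_map_on_def dual_action_def Rmul_def to_bidual_def n_apply \<Delta>_bilinear)
  from to_bidual_from_bidual[OF fin_dim this \<eta>]
  show "\<eta> (\<rho>2 \<xi> x) = \<Delta> (\<alpha> (\<alpha> x)) \<eta> (\<gamma> \<xi>)"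
    by (simp add: \<rho>2_def Rstar_dual_def to_bidual_def dual_action_def Rmul_def n_apply dualD[OF \<eta>])
  have "linear_map_on fun_scale D (*) UNIV
      (dual_action (Lmul n) (\<gamma> \<xi>) (to_bidual ((\<alpha> \<circ> \<alpha>) x)))"
    using \<gamma>_closed[OF \<xi>]
    by (simp add: linear_map_on_def dual_action_def Lmul_def to_bidual_def n_apply \<Delta>_bilinear)
  from to_bidual_from_bidual[OF fin_dim this \<eta>]
  show "\<eta> (\<mu>2 \<xi> x) = \<Delta> (\<alpha> (\<alpha> x)) (\<gamma> \<xi>) \<eta>"
    by (simp add: \<mu>2_def Lstar_dual_def to_bidual_def dual_action_def Lmul_def n_apply dualD[OF \<eta>])
qed

lemma vector_eqI: "(\<And>\<xi>. \<xi> \<in> D \<Longrightarrow> \<xi> x = \<xi> y) \<Longrightarrow> x = y"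
  by (rule dual_separates[OF vector_space_scale])

lemma action2_linear:
  assumes "\<xi> \<in> D" "\<eta> \<in> D"
  shows "\<rho>2 (\<xi> + \<eta>) x = \<rho>2 \<xi> x + \<rho>2 \<eta> x" "\<rho>2 (fun_scale c \<xi>) x = scale c (\<rho>2 \<xi> x)"
    "\<mu>2 (\<xi> + \<eta>) x = \<mu>2 \<xi> x + \<mu>2 \<eta> x" "\<mu>2 (fun_scale c \<xi>) x = scale c (\<mu>2 \<xi> x)"
    "\<rho>2 \<xi> (x + y) = \<rho>2 \<xi> x + \<rho>2 \<xi> y" "\<rho>2 \<xi> (scale c x) = scale c (\<rho>2 \<xi> x)"
    "\<mu>2 \<xi> (x + y) = \<mu>2 \<xi> x + \<mu>2 \<xi> y" "\<mu>2 \<xi> (scale c x) = scale c (\<mu>2 \<xi> x)"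
proof -
  have "\<gamma> (\<xi> + \<eta>) = \<gamma> \<xi> + \<gamma> \<eta>" "\<gamma> (fun_scale c \<xi>) = fun_scale c (\<gamma> \<xi>)"
    by (auto simp: \<gamma>_apply fun_scale_def)
  with assms show "\<rho>2 (\<xi> + \<eta>) x = \<rho>2 \<xi> x + \<rho>2 \<eta> x" "\<rho>2 (fun_scale c \<xi>) x = scale c (\<rho>2 \<xi> x)"
    "\<mu>2 (\<xi> + \<eta>) x = \<mu>2 \<xi> x + \<mu>2 \<eta> x" "\<mu>2 (fun_scale c \<xi>) x = scale c (\<mu>2 \<xi> x)"
    by (auto intro!: vector_eqI simp: \<rho>2_pairing \<mu>2_pairing dualD dual_closed \<Delta>_bilinear \<gamma>_closed)
  from assms show "\<rho>2 \<xi> (x + y) = \<rho>2 \<xi> x + \<rho>2 \<xi> y" "\<rho>2 \<xi> (scale c x) = scale c (\<rho>2 \<xi> x)"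
    "\<mu>2 \<xi> (x + y) = \<mu>2 \<xi> x + \<mu>2 \<xi> y" "\<mu>2 \<xi> (scale c x) = scale c (\<mu>2 \<xi> x)"
    by (auto intro!: vector_eqI simp: \<rho>2_pairing \<mu>2_pairing dualD \<Delta>_linear \<alpha>_add \<alpha>_scale)
qed

lemma \<Delta>_\<alpha>: "\<xi> \<in> D \<Longrightarrow> \<eta> \<in> D \<Longrightarrow> \<Delta> (\<alpha> x) (\<gamma> \<xi>) (\<gamma> \<eta>) = \<Delta> x \<xi> \<eta>"
  by (simp add: \<Delta>_\<beta>)

text \<open>
  Both representations intertwine the twists; this needs multiplicativity of \<open>\<alpha>\<close> on the first space
  and of its inverse transpose on the second.
\<close>

lemma action_twist:
  assumes "\<xi> \<in> D"
  shows "\<rho>1 (\<alpha> x) (\<gamma> \<xi>) = \<gamma> (\<rho>1 x \<xi>)" "\<mu>1 (\<alpha> x) (\<gamma> \<xi>) = \<gamma> (\<mu>1 x \<xi>)"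
    "\<rho>2 (\<gamma> \<xi>) (\<alpha> x) = \<alpha> (\<rho>2 \<xi> x)" "\<mu>2 (\<gamma> \<xi>) (\<alpha> x) = \<alpha> (\<mu>2 \<xi> x)"
proof -
  show "\<rho>1 (\<alpha> x) (\<gamma> \<xi>) = \<gamma> (\<rho>1 x \<xi>)" "\<mu>1 (\<alpha> x) (\<gamma> \<xi>) = \<gamma> (\<mu>1 x \<xi>)"
    by (simp_all add: fun_eq_iff \<rho>1_apply \<mu>1_apply \<gamma>_apply \<beta>_mult)
  have "\<eta> (\<rho>2 (\<gamma> \<xi>) (\<alpha> x)) = \<eta> (\<alpha> (\<rho>2 \<xi> x))" "\<eta> (\<mu>2 (\<gamma> \<xi>) (\<alpha> x)) = \<eta> (\<alpha> (\<mu>2 \<xi> x))"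
    if \<eta>: "\<eta> \<in> D" for \<eta>
  proof -
    have \<eta>': "(\<lambda>v. \<eta> (\<alpha> v)) \<in> D" using \<eta> by (rule dual_comp)
    have g: "\<gamma> (\<lambda>v. \<eta> (\<alpha> v)) = \<eta>" by (simp add: fun_eq_iff \<gamma>_apply)
    show "\<eta> (\<rho>2 (\<gamma> \<xi>) (\<alpha> x)) = \<eta> (\<alpha> (\<rho>2 \<xi> x))"
      using \<rho>2_pairing[OF assms \<eta>', of x] \<rho>2_pairing[OF \<gamma>_closed[OF assms] \<eta>, of "\<alpha> x"]
        \<Delta>_\<alpha>[OF \<eta>' \<gamma>_closed[OF assms], of "\<alpha> (\<alpha> x)"] by (simp add: g)
    show "\<eta> (\<mu>2 (\<gamma> \<xi>) (\<alpha> x)) = \<eta> (\<alpha> (\<mu>2 \<xi> x))"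
      using \<mu>2_pairing[OF assms \<eta>', of x] \<mu>2_pairing[OF \<gamma>_closed[OF assms] \<eta>, of "\<alpha> x"]
        \<Delta>_\<alpha>[OF \<gamma>_closed[OF assms] \<eta>', of "\<alpha> (\<alpha> x)"] by (simp add: g)
  qed
  then show "\<rho>2 (\<gamma> \<xi>) (\<alpha> x) = \<alpha> (\<rho>2 \<xi> x)" "\<mu>2 (\<gamma> \<xi>) (\<alpha> x) = \<alpha> (\<mu>2 \<xi> x)"
    by (auto intro: vector_eqI)
qed

lemma action_zero: "\<rho>2 0 x = 0" "\<mu>2 0 x = 0" "\<xi> \<in> D \<Longrightarrow> \<rho>2 \<xi> 0 = 0" "\<xi> \<in> D \<Longrightarrow> \<mu>2 \<xi> 0 = 0"
  "\<rho>1 x 0 = 0" "\<mu>1 x 0 = 0" "\<xi> \<in> D \<Longrightarrow> \<rho>1 0 \<xi> = 0" "\<xi> \<in> D \<Longrightarrow> \<mu>1 0 \<xi> = 0"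
  "\<gamma> 0 = 0" "\<alpha> 0 = 0" "\<beta> 0 = 0"
proof -
  show a: "\<alpha> 0 = 0" "\<beta> 0 = 0" using \<alpha>_add[of 0 0] \<beta>_add[of 0 0] by simp_all
  show "\<rho>2 0 x = 0" "\<mu>2 0 x = 0"
   using action2_linear(1,3)[OF dual_closed(1) dual_closed(1), of x] by simp_all
  show "\<rho>2 \<xi> 0 = 0" "\<mu>2 \<xi> 0 = 0" if "\<xi> \<in> D"
   using action2_linear(5,7)[OF that dual_closed(1), of 0 0] by simp_all
  show "\<rho>1 x 0 = 0" "\<mu>1 x 0 = 0" by (simp_all add: fun_eq_iff \<rho>1_apply \<mu>1_apply)
  show "\<rho>1 0 \<xi> = 0" "\<mu>1 0 \<xi> = 0" if "\<xi> \<in> D" using that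
   by (simp_all add: fun_eq_iff \<rho>1_apply \<mu>1_apply a mult_zero dualD)
  show "\<gamma> 0 = 0" by (simp add: fun_eq_iff \<gamma>_apply)
qed

lemma n_zero: "\<xi> \<in> D \<Longrightarrow> n 0 \<xi> = 0" "\<xi> \<in> D \<Longrightarrow> n \<xi> 0 = 0"
  by (simp_all add: fun_eq_iff n_apply \<Delta>_zero dual_closed)


section \<open>The double and its invariant pairing\<close>

definition E :: "('a \<times> ('a \<Rightarrow> 'f)) set" where "E = UNIV \<times> D"

definition dmul :: "'a \<times> ('a \<Rightarrow> 'f) \<Rightarrow> 'a \<times> ('a \<Rightarrow> 'f) \<Rightarrow> 'a \<times> ('a \<Rightarrow> 'f)" where
  "dmul X Y = (m (fst X) (fst Y) + \<rho>2 (snd X) (fst Y) + \<mu>2 (snd Y) (fst X),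
               n (snd X) (snd Y) + \<rho>1 (fst X) (snd Y) + \<mu>1 (fst Y) (snd X))"

definition dtwist :: "'a \<times> ('a \<Rightarrow> 'f) \<Rightarrow> 'a \<times> ('a \<Rightarrow> 'f)" where
  "dtwist X = (\<alpha> (fst X), \<gamma> (snd X))"

definition pairing :: "'a \<times> ('a \<Rightarrow> 'f) \<Rightarrow> 'a \<times> ('a \<Rightarrow> 'f) \<Rightarrow> 'f" where
  "pairing X Y = snd X (fst Y) + snd Y (fst X)"

text \<open>
  All relations below are linear relations between values of this one function.
\<close>

definition quad where "quad X Y Z W = pairing (dmul X Y) (dmul Z W)"

lemma dmul_closed: "X \<in> E \<Longrightarrow> Y \<in> E \<Longrightarrow> dmul X Y \<in> E"
  by (auto simp: E_def dmul_def intro!: dual_closed n_closed action1_closed)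

lemma dtwist_closed: "X \<in> E \<Longrightarrow> dtwist X \<in> E"
  by (auto simp: E_def dtwist_def \<gamma>_closed)

lemma pairing_commute: "pairing X Y = pairing Y X"
  by (simp add: pairing_def add.commute)

lemma pairing_dtwist: "pairing (dtwist X) (dtwist Y) = pairing X Y"
  by (simp add: pairing_def dtwist_def \<gamma>_apply)

lemma dtwist_dmul: "X \<in> E \<Longrightarrow> Y \<in> E \<Longrightarrow> dtwist (dmul X Y) = dmul (dtwist X) (dtwist Y)"
  by (auto simp: E_def dtwist_def dmul_def \<alpha>_add \<alpha>_mult action_twist n_\<gamma>[symmetric] fun_eq_iff
      \<gamma>_apply)

text \<open>
  For \<open>X = (x, a)\<close>, \<open>Y = (y, b)\<close>, \<open>Z = (z, c)\<close> the six terms of the pairing are \<open>\<Delta> (\<alpha> z) a b\<close> and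
  \<open>c (\<beta> x \<diamond> \<beta> y)\<close> together with their images under cyclic rotation: the products of the two algebras
  contribute these two terms, and each of the four actions contributes one of the rotated ones.
\<close>

lemma pairing_dmul_cyclic:
  assumes "X \<in> E" "Y \<in> E" "Z \<in> E"
  shows "pairing (dmul X Y) (dtwist Z) = pairing (dmul Y Z) (dtwist X)"
proof -
  obtain x a y b z c where X: "X = (x, a)" "Y = (y, b)" "Z = (z, c)"
    and D: "a \<in> D" "b \<in> D" "c \<in> D"
    using assms by (auto simp: E_def)
  have p: "pairing (dmul (x, a) (y, b)) (dtwist (z, c))
      = \<Delta> (\<alpha> z) a b + \<Delta> (\<alpha> y) c a + \<Delta> (\<alpha> x) b c
        + a (m (\<beta> y) (\<beta> z)) + b (m (\<beta> z) (\<beta> x)) + c (m (\<beta> x) (\<beta> y))"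
    if D: "a \<in> D" "b \<in> D" "c \<in> D" for x a y b z c
    using \<rho>2_pairing[OF D(1) \<gamma>_closed[OF D(3)]] \<mu>2_pairing[OF D(2) \<gamma>_closed[OF D(3)]]
    by (simp add: pairing_def dmul_def dtwist_def dualD D \<gamma>_apply[of c] \<gamma>_closed \<rho>1_apply
        \<mu>1_apply n_apply \<beta>_add \<beta>_mult \<Delta>_\<alpha>)
  show ?thesis unfolding X p[OF D] p[OF D(2,3,1)] by (simp add: algebra_simps)
qed

text \<open>
  Rotate so that the twisted factors \<open>\<alpha> Z\<close> and \<open>\<alpha> W\<close> are multiplied with one another; their product
  is then a twist, and orthogonality removes it.
\<close>

lemma quad_left:
  assumes "X \<in> E" "Y \<in> E" "Z \<in> E" "W \<in> E"
  shows "pairing (dmul (dmul X Y) (dtwist Z)) (dtwist (dtwist W)) = quad X Y Z W"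
proof -
  have "pairing (dmul (dmul X Y) (dtwist Z)) (dtwist (dtwist W))
      = pairing (dmul (dtwist Z) (dtwist W)) (dtwist (dmul X Y))"
    using assms by (metis pairing_dmul_cyclic dmul_closed dtwist_closed)
  then show ?thesis
    using assms by (simp add: dtwist_dmul[symmetric] pairing_dtwist quad_def pairing_commute)
qed

lemma quad_right:
  assumes "X \<in> E" "Y \<in> E" "Z \<in> E" "W \<in> E"
  shows "pairing (dmul (dtwist X) (dmul Y Z)) (dtwist (dtwist W)) = quad Y Z W X"
proof -
  have "pairing (dmul (dtwist X) (dmul Y Z)) (dtwist (dtwist W))
      = pairing (dmul (dtwist W) (dtwist X)) (dtwist (dmul Y Z))"
    using assms by (metis pairing_dmul_cyclic dmul_closed dtwist_closed)
  then show ?thesis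
    using assms by (simp add: dtwist_dmul[symmetric] pairing_dtwist quad_def pairing_commute)
qed

lemma quad_sym: "quad X Y Z W = quad Z W X Y"
  by (simp add: quad_def pairing_commute)


section \<open>The admissible identity on the double\<close>

abbreviation J where "J \<equiv> cyclic_identity quad"

lemma cyclic_identity_pairing:
  assumes "X \<in> E" "Y \<in> E" "Z \<in> E" "W \<in> E"
  shows "J X Y Z W \<longleftrightarrow>
    (let ev = (\<lambda>P. pairing P (dtwist (dtwist W)))
     in ev (dmul (dmul X Y) (dtwist Z)) = ev (dmul (dtwist X) (dmul Y Z))
      - 1/3 * (- ev (dmul (dtwist X) (dmul Z Y)) + ev (dmul (dtwist Z) (dmul X Y))
          + ev (dmul (dtwist Y) (dmul X Z)) - ev (dmul (dtwist Y) (dmul Z X))))"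
  using assms by (simp add: cyclic_identity_def quad_left quad_right)

text \<open>
  Pairing with covectors detects the first component of an element of the double and pairing with
  vectors the second, so the two components of the admissible identity can be tested separately.
\<close>

lemma fst_identity_iff:
  assumes "X \<in> E" "Y \<in> E" "Z \<in> E"
  shows "fst (dmul (dmul X Y) (dtwist Z)) = fst (dmul (dtwist X) (dmul Y Z))
      - scale (1/3) (- fst (dmul (dtwist X) (dmul Z Y)) + fst (dmul (dtwist Z) (dmul X Y))
          + fst (dmul (dtwist Y) (dmul X Z)) - fst (dmul (dtwist Y) (dmul Z X)))
    \<longleftrightarrow> (\<forall>e\<in>D. J X Y Z (0, e))" (is "?l = ?r \<longleftrightarrow> _")
proof -
  have fst_eq: "pairing P (dtwist (dtwist (0, e))) = \<gamma> (\<gamma> e) (fst P)" if "P \<in> E" for P e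
    using that by (auto simp: E_def pairing_def dtwist_def action_zero dualD)
  have E0: "(0, e) \<in> E" if "e \<in> D" for e using that by (simp add: E_def)
  note cl = dmul_closed dtwist_closed
  have J: "J X Y Z (0, e) \<longleftrightarrow> \<gamma> (\<gamma> e) ?l = \<gamma> (\<gamma> e) ?r" if e: "e \<in> D" for e
    using e assms by (simp add: cyclic_identity_pairing E0 fst_eq cl dualD \<gamma>_closed)
  have "\<eta> ?l = \<eta> ?r" if "\<forall>e\<in>D. J X Y Z (0, e)" "\<eta> \<in> D" for \<eta>
  proof -
    \<comment> \<open>the functional whose second twist is \<open>\<eta>\<close>\<close>
    have e: "(\<lambda>v. \<eta> (\<alpha> (\<alpha> v))) \<in> D"
      using dual_comp(3)[OF dual_comp(3)[OF that(2)]] by simp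
    have "\<gamma> (\<gamma> (\<lambda>v. \<eta> (\<alpha> (\<alpha> v)))) = \<eta>" by (simp add: fun_eq_iff \<gamma>_apply)
    with J[OF e] that(1) e show ?thesis by simp
  qed
  with J show ?thesis by (metis vector_eqI)
qed

lemma snd_identity_iff:
  assumes "X \<in> E" "Y \<in> E" "Z \<in> E"
  shows "snd (dmul (dmul X Y) (dtwist Z)) = snd (dmul (dtwist X) (dmul Y Z))
      - fun_scale (1/3) (- snd (dmul (dtwist X) (dmul Z Y)) + snd (dmul (dtwist Z) (dmul X Y))
          + snd (dmul (dtwist Y) (dmul X Z)) - snd (dmul (dtwist Y) (dmul Z X)))
    \<longleftrightarrow> (\<forall>w. J X Y Z (w, 0))" (is "?l = ?r \<longleftrightarrow> _")
proof -
  have snd_eq: "pairing P (dtwist (dtwist (w, 0))) = snd P (\<alpha> (\<alpha> w))" if "P \<in> E" for P w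
    using that by (auto simp: E_def pairing_def dtwist_def action_zero dualD)
  have E0: "(w, 0) \<in> E" for w by (simp add: E_def dual_closed)
  note cl = dmul_closed dtwist_closed
  have J: "J X Y Z (w, 0) \<longleftrightarrow> ?l (\<alpha> (\<alpha> w)) = ?r (\<alpha> (\<alpha> w))" for w
    using assms by (simp add: cyclic_identity_pairing E0 snd_eq cl fun_scale_def)
  have "?l v = ?r v" if "\<forall>w. J X Y Z (w, 0)" for v
    using J[of "\<beta> (\<beta> v)"] that by simp
  with J show ?thesis by (metis ext)
qed


abbreviation vec :: "'a \<Rightarrow> 'a \<times> ('a \<Rightarrow> 'f)" where "vec x \<equiv> (x, 0)"
abbreviation cov :: "('a \<Rightarrow> 'f) \<Rightarrow> 'a \<times> ('a \<Rightarrow> 'f)" where "cov \<xi> \<equiv> (0, \<xi>)"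

lemma vec_cov_in: "vec x \<in> E" "\<xi> \<in> D \<Longrightarrow> cov \<xi> \<in> E"
  by (simp_all add: E_def dual_closed)

lemma dmul_pure:
  "dmul (vec x) (vec y) = vec (m x y)"
  "\<xi> \<in> D \<Longrightarrow> \<eta> \<in> D \<Longrightarrow> dmul (cov \<xi>) (cov \<eta>) = cov (n \<xi> \<eta>)"
  "\<xi> \<in> D \<Longrightarrow> dmul (vec x) (cov \<xi>) = (\<mu>2 \<xi> x, \<rho>1 x \<xi>)"
  "\<xi> \<in> D \<Longrightarrow> dmul (cov \<xi>) (vec x) = (\<rho>2 \<xi> x, \<mu>1 x \<xi>)"
  by (simp_all add: dmul_def action_zero mult_zero n_zero dual_closed)

lemma dmul_vec:
  "dmul (vec x) (y, \<eta>) = (m x y + \<mu>2 \<eta> x, \<rho>1 x \<eta>)"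
  "dmul (y, \<eta>) (vec x) = (m y x + \<rho>2 \<eta> x, \<mu>1 x \<eta>)"
  if "\<eta> \<in> D"
  using that by (simp_all add: dmul_def action_zero mult_zero n_zero)

lemma dmul_cov:
  "dmul (cov \<xi>) (y, \<eta>) = (\<rho>2 \<xi> y, n \<xi> \<eta> + \<mu>1 y \<xi>)"
  "dmul (y, \<eta>) (cov \<xi>) = (\<mu>2 \<xi> y, n \<eta> \<xi> + \<rho>1 y \<xi>)"
  if "\<eta> \<in> D" "\<xi> \<in> D"
  using that by (simp_all add: dmul_def action_zero mult_zero n_zero)

lemma dtwist_pure: "dtwist (vec x) = vec (\<alpha> x)" "dtwist (cov \<xi>) = cov (\<gamma> \<xi>)"
  by (simp_all add: dtwist_def action_zero)

lemmas pure = dmul_pure dmul_vec dmul_cov dtwist_pure action1_closed \<gamma>_closed n_closed dual_closed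
  action_zero mult_zero n_zero

lemma identity_on_vectors:
  assumes e: "e \<in> D"
  shows "J (vec x) (vec y) (vec z) (cov e)"
proof -
  have "\<forall>e\<in>D. J (vec x) (vec y) (vec z) (cov e)"
    by (subst fst_identity_iff[symmetric]) (simp_all add: vec_cov_in pure mult_admissible)
  with e show ?thesis by blast
qed

lemma identity_on_covectors:
  assumes "a \<in> D" "b \<in> D" "c \<in> D"
  shows "J (cov a) (cov b) (cov c) (vec w)"
proof -
  have "\<forall>w. J (cov a) (cov b) (cov c) (vec w)"
    using assms by (subst snd_identity_iff[symmetric]) (simp_all add: vec_cov_in pure n_admissible)
  then show ?thesis by blast
qed

lemmas rotate = cyclic_identity_rotate[of quad, OF three quad_sym]

text \<open>
  With the covector last these relations are the identity of \<open>A\<close>; rotating a vector into the last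
  place yields the relations that make \<open>A*\<close> a representation of \<open>A\<close>.
\<close>

lemma identity_three_vectors:
  assumes a: "a \<in> D"
  shows "J (vec x) (vec y) (cov a) (vec w)" "J (vec x) (cov a) (vec y) (vec w)"
    "J (cov a) (vec x) (vec y) (vec w)"
  using rotate[of "vec x" "vec y" "vec w" "cov a"] assms by (simp_all add: identity_on_vectors)

lemma identity_three_covectors:
  assumes "a \<in> D" "b \<in> D" "c \<in> D"
  shows "J (cov a) (cov b) (vec x) (cov c)" "J (cov a) (vec x) (cov b) (cov c)"
    "J (vec x) (cov a) (cov b) (cov c)"
  using rotate[of "cov a" "cov b" "cov c" "vec x"] assms by (simp_all add: identity_on_covectors)

text \<open>
  The step from the first three compatibility conditions to the other three: among the relations in
  two vectors and two covectors, those with a covector last rotate to those with a vector last.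
\<close>

lemma identity_output_vector:
  assumes "\<forall>x y. \<forall>a\<in>D. \<forall>e\<in>D. J (vec x) (vec y) (cov a) (cov e)"
    and "\<forall>x y. \<forall>a\<in>D. \<forall>e\<in>D. J (cov a) (vec x) (vec y) (cov e)"
    and "\<forall>x y. \<forall>a\<in>D. \<forall>e\<in>D. J (vec x) (cov a) (vec y) (cov e)"
    and "a \<in> D" "b \<in> D"
  shows "J (vec x) (cov a) (cov b) (vec y)" "J (cov a) (vec x) (cov b) (vec y)"
    "J (cov a) (cov b) (vec x) (vec y)"
  using rotate[of "vec x" "cov a" "vec y" "cov b"] rotate[of "cov a" "vec x" "vec y" "cov b"] assms
  by simp_all


section \<open>Matched pairs\<close>

text \<open>
  Each compatibility condition is one component of the admissible identity of the double, for two
  arguments from one space and one from the other. The letters in the names give the order of the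
  arguments: \<open>x, y\<close> are vectors and \<open>a, b\<close> covectors.
\<close>

lemma condition_xya_iff:
  assumes a: "a \<in> D"
  shows "\<mu>2 (\<gamma> a) (m x y) =
          \<mu>2 (\<rho>1 y a) (\<alpha> x) + m (\<alpha> x) (\<mu>2 a y)
          + scale (1/3) (\<mu>2 (\<mu>1 y a) (\<alpha> x) + m (\<alpha> x) (\<rho>2 a y) - \<rho>2 (\<gamma> a) (m x y)
              - m (\<alpha> y) (\<mu>2 a x) - \<mu>2 (\<rho>1 x a) (\<alpha> y) + m (\<alpha> y) (\<rho>2 a x)
              + \<mu>2 (\<mu>1 x a) (\<alpha> y))
     \<longleftrightarrow> (\<forall>e\<in>D. J (vec x) (vec y) (cov a) (cov e))"
  using a by (subst fst_identity_iff[symmetric])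
    (simp_all add: vec_cov_in pure scale_right_distrib scale_right_diff_distrib algebra_simps)

lemma condition_axy_iff:
  assumes a: "a \<in> D"
  shows "\<rho>2 (\<gamma> a) (m x y) =
          m (\<rho>2 a x) (\<alpha> y) + \<rho>2 (\<mu>1 x a) (\<alpha> y)
          + scale (1/3) (- \<rho>2 (\<gamma> a) (m y x) + m (\<alpha> y) (\<rho>2 a x) + \<mu>2 (\<mu>1 x a) (\<alpha> y)
              + m (\<alpha> x) (\<rho>2 a y) + \<mu>2 (\<mu>1 y a) (\<alpha> x) - m (\<alpha> x) (\<mu>2 a y)
              - \<mu>2 (\<rho>1 y a) (\<alpha> x))
     \<longleftrightarrow> (\<forall>e\<in>D. J (cov a) (vec x) (vec y) (cov e))"
  using a by (subst fst_identity_iff[symmetric])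
    (auto simp add: vec_cov_in pure scale_right_distrib scale_right_diff_distrib algebra_simps)

lemma condition_xay_iff:
  assumes a: "a \<in> D"
  shows "m (\<mu>2 a x) (\<alpha> y) =
          - \<rho>2 (\<rho>1 x a) (\<alpha> y) + m (\<alpha> x) (\<rho>2 a y) + \<mu>2 (\<mu>1 y a) (\<alpha> x)
          + scale (1/3) (m (\<alpha> x) (\<mu>2 a y) + \<mu>2 (\<rho>1 y a) (\<alpha> x) - m (\<alpha> y) (\<mu>2 a x)
              - \<mu>2 (\<rho>1 x a) (\<alpha> y) - \<rho>2 (\<gamma> a) (m x y) + \<rho>2 (\<gamma> a) (m y x))
     \<longleftrightarrow> (\<forall>e\<in>D. J (vec x) (cov a) (vec y) (cov e))"
  using a by (subst fst_identity_iff[symmetric])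
    (auto simp add: vec_cov_in pure scale_right_distrib scale_right_diff_distrib algebra_simps)

lemma condition_abx_iff:
  assumes "a \<in> D" "b \<in> D"
  shows "\<mu>1 (\<alpha> x) (n a b) =
          \<mu>1 (\<rho>2 b x) (\<gamma> a) + n (\<gamma> a) (\<mu>1 x b)
          + fun_scale (1/3) (\<mu>1 (\<mu>2 b x) (\<gamma> a) + n (\<gamma> a) (\<rho>1 x b) - \<rho>1 (\<alpha> x) (n a b)
              - n (\<gamma> b) (\<mu>1 x a) - \<mu>1 (\<rho>2 a x) (\<gamma> b) + n (\<gamma> b) (\<rho>1 x a)
              + \<mu>1 (\<mu>2 a x) (\<gamma> b))
     \<longleftrightarrow> (\<forall>w. J (cov a) (cov b) (vec x) (vec w))"
  using assms by (subst snd_identity_iff[symmetric])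
    (auto simp add: vec_cov_in pure F.scale_right_distrib F.scale_right_diff_distrib algebra_simps)

lemma condition_xab_iff:
  assumes "a \<in> D" "b \<in> D"
  shows "\<rho>1 (\<alpha> x) (n a b) =
          n (\<rho>1 x a) (\<gamma> b) + \<rho>1 (\<mu>2 a x) (\<gamma> b)
          + fun_scale (1/3) (- \<rho>1 (\<alpha> x) (n b a) + n (\<gamma> b) (\<rho>1 x a) + \<mu>1 (\<mu>2 a x) (\<gamma> b)
              + n (\<gamma> a) (\<rho>1 x b) + \<mu>1 (\<mu>2 b x) (\<gamma> a) - n (\<gamma> a) (\<mu>1 x b)
              - \<mu>1 (\<rho>2 b x) (\<gamma> a))
     \<longleftrightarrow> (\<forall>w. J (vec x) (cov a) (cov b) (vec w))"
  using assms by (subst snd_identity_iff[symmetric])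
    (auto simp add: vec_cov_in pure F.scale_right_distrib F.scale_right_diff_distrib algebra_simps)

lemma condition_axb_iff:
  assumes "a \<in> D" "b \<in> D"
  shows "n (\<mu>1 x a) (\<gamma> b) =
          - \<rho>1 (\<rho>2 a x) (\<gamma> b) + n (\<gamma> a) (\<rho>1 x b) + \<mu>1 (\<mu>2 b x) (\<gamma> a)
          + fun_scale (1/3) (n (\<gamma> a) (\<mu>1 x b) + \<mu>1 (\<rho>2 b x) (\<gamma> a) - n (\<gamma> b) (\<mu>1 x a)
              - \<mu>1 (\<rho>2 a x) (\<gamma> b) - \<rho>1 (\<alpha> x) (n a b) + \<rho>1 (\<alpha> x) (n b a))
     \<longleftrightarrow> (\<forall>w. J (cov a) (vec x) (cov b) (vec w))"
  using assms by (subst snd_identity_iff[symmetric])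
    (auto simp add: vec_cov_in pure F.scale_right_distrib F.scale_right_diff_distrib algebra_simps)

text \<open>
  The remaining component of the identity for two vectors and one covector consists of the three
  axioms of a representation, one for each position of the covector.
\<close>

lemma representation_on_dual: "hom_poisson_rep scale UNIV m \<alpha> fun_scale D \<rho>1 \<mu>1 \<gamma>"
proof -
  have lin: "linear_map_on fun_scale D fun_scale D \<gamma>"
    using dual_algebra by (simp add: admissible_hom_poisson_def)
  have bil: "bilinear_map_on scale UNIV fun_scale D fun_scale D \<rho>1"
    "bilinear_map_on scale UNIV fun_scale D fun_scale D \<mu>1"
    by (auto simp: bilinear_map_on_def linear_map_on_def action1_closed fun_eq_iff \<rho>1_apply
        \<mu>1_apply fun_scale_def \<beta>_add \<beta>_scale mult_linear dualD)
  have
    "\<rho>1 (m x y) (\<gamma> v) = \<rho>1 (\<alpha> x) (\<rho>1 y v)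
       - fun_scale (1/3) (- \<rho>1 (\<alpha> x) (\<mu>1 y v) + \<mu>1 (m x y) (\<gamma> v)
           + \<rho>1 (\<alpha> y) (\<rho>1 x v) - \<rho>1 (\<alpha> y) (\<mu>1 x v))"
    "\<mu>1 (\<alpha> y) (\<rho>1 x v) = \<rho>1 (\<alpha> x) (\<mu>1 y v)
       - fun_scale (1/3) (- \<rho>1 (\<alpha> x) (\<rho>1 y v) + \<rho>1 (\<alpha> y) (\<rho>1 x v)
           + \<mu>1 (m x y) (\<gamma> v) - \<mu>1 (m y x) (\<gamma> v))"
    "\<mu>1 (\<alpha> y) (\<mu>1 x v) = \<mu>1 (m x y) (\<gamma> v)
       - fun_scale (1/3) (- \<mu>1 (m y x) (\<gamma> v) + \<rho>1 (\<alpha> y) (\<mu>1 x v)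
           + \<rho>1 (\<alpha> x) (\<mu>1 y v) - \<rho>1 (\<alpha> x) (\<rho>1 y v))"
    if v: "v \<in> D" for x y v
    using snd_identity_iff[of "vec x" "vec y" "cov v"] snd_identity_iff[of "vec x" "cov v" "vec y"]
      snd_identity_iff[of "cov v" "vec x" "vec y"]
    by (simp_all add: identity_three_vectors vec_cov_in pure v)
  then show ?thesis
    unfolding hom_poisson_rep_def using fin_dim_dual lin bil action_twist by simp
qed

lemma representation_on_space: "hom_poisson_rep fun_scale D n \<gamma> scale UNIV \<rho>2 \<mu>2 \<alpha>"
proof -
  have lin: "linear_map_on scale UNIV scale UNIV \<alpha>"
    by (simp add: linear_map_on_def \<alpha>_add \<alpha>_scale)
  have bil: "bilinear_map_on fun_scale D scale UNIV scale UNIV \<rho>2"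
    "bilinear_map_on fun_scale D scale UNIV scale UNIV \<mu>2"
    by (auto simp: bilinear_map_on_def linear_map_on_def action2_linear)
  have
    "\<rho>2 (n a b) (\<alpha> x) = \<rho>2 (\<gamma> a) (\<rho>2 b x)
       - scale (1/3) (- \<rho>2 (\<gamma> a) (\<mu>2 b x) + \<mu>2 (n a b) (\<alpha> x)
           + \<rho>2 (\<gamma> b) (\<rho>2 a x) - \<rho>2 (\<gamma> b) (\<mu>2 a x))"
    "\<mu>2 (\<gamma> b) (\<rho>2 a x) = \<rho>2 (\<gamma> a) (\<mu>2 b x)
       - scale (1/3) (- \<rho>2 (\<gamma> a) (\<rho>2 b x) + \<rho>2 (\<gamma> b) (\<rho>2 a x)
           + \<mu>2 (n a b) (\<alpha> x) - \<mu>2 (n b a) (\<alpha> x))"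
    "\<mu>2 (\<gamma> b) (\<mu>2 a x) = \<mu>2 (n a b) (\<alpha> x)
       - scale (1/3) (- \<mu>2 (n b a) (\<alpha> x) + \<rho>2 (\<gamma> b) (\<mu>2 a x)
           + \<rho>2 (\<gamma> a) (\<mu>2 b x) - \<rho>2 (\<gamma> a) (\<rho>2 b x))"
    if ab: "a \<in> D" "b \<in> D" for x a b
    using fst_identity_iff[of "cov a" "cov b" "vec x"] fst_identity_iff[of "cov a" "vec x" "cov b"]
      fst_identity_iff[of "vec x" "cov a" "cov b"]
    by (simp_all add: identity_three_covectors vec_cov_in pure ab)
  then show ?thesis
    unfolding hom_poisson_rep_def using fin_dim lin bil action_twist by simp
qed

lemma matched_pair_iff:
  "matched_pair scale UNIV m fun_scale D n \<rho>1 \<mu>1 \<rho>2 \<mu>2 \<alpha> \<gamma> \<longleftrightarrow>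
    (\<forall>x y. \<forall>a\<in>D. \<forall>e\<in>D. J (vec x) (vec y) (cov a) (cov e)) \<and>
    (\<forall>x y. \<forall>a\<in>D. \<forall>e\<in>D. J (cov a) (vec x) (vec y) (cov e)) \<and>
    (\<forall>x y. \<forall>a\<in>D. \<forall>e\<in>D. J (vec x) (cov a) (vec y) (cov e))"
proof -
  have alg: "admissible_hom_poisson scale UNIV m \<alpha>"
    using algebra by (simp add: regular_admissible_hom_poisson_def)
  have "matched_pair scale UNIV m fun_scale D n \<rho>1 \<mu>1 \<rho>2 \<mu>2 \<alpha> \<gamma> \<longleftrightarrow>
    (\<forall>x y. \<forall>a\<in>D. \<forall>e\<in>D. J (vec x) (vec y) (cov a) (cov e)) \<and>
    (\<forall>x y. \<forall>a\<in>D. \<forall>e\<in>D. J (cov a) (vec x) (vec y) (cov e)) \<and>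
    (\<forall>x y. \<forall>a\<in>D. \<forall>e\<in>D. J (vec x) (cov a) (vec y) (cov e)) \<and>
    (\<forall>x. \<forall>a\<in>D. \<forall>b\<in>D. \<forall>y. J (cov a) (cov b) (vec x) (vec y)) \<and>
    (\<forall>x. \<forall>a\<in>D. \<forall>b\<in>D. \<forall>y. J (vec x) (cov a) (cov b) (vec y)) \<and>
    (\<forall>x. \<forall>a\<in>D. \<forall>b\<in>D. \<forall>y. J (cov a) (vec x) (cov b) (vec y))"
    by (simp only: matched_pair_def alg dual_algebra representation_on_dual representation_on_space
        condition_xya_iff condition_axy_iff condition_xay_iff condition_abx_iff condition_xab_iff
        condition_axb_iff
        ball_UNIV simp_thms cong: ball_cong)
  then show ?thesis by (simp add: identity_output_vector cong: conj_cong)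
qed


section \<open>The three equations for the coproduct\<close>

text \<open>
  The arguments \<open>\<lambda>v. a (m v (\<beta> x))\<close> and \<open>\<lambda>v. e (\<alpha> v)\<close> are transposes applied to \<open>a\<close> and \<open>e\<close>; so the
  first summand of the second equation is the pairing of \<open>a \<otimes> e\<close> with the image of \<open>\<Delta> y\<close> under
  \<open>R(\<beta> x) \<otimes> \<alpha>\<close>, and similarly for the others. A mixed product has two components, whence the two
  summands.
\<close>

lemma quad_values:
  assumes "a \<in> D" "e \<in> D"
  shows "quad (vec x) (vec y) (cov a) (cov e) = \<Delta> (m x y) a e"
   "quad (vec x) (cov a) (cov e) (vec y)
     = \<Delta> y (\<lambda>v. a (m v (\<beta> x))) (\<lambda>v. e (\<alpha> v))
       + \<Delta> x (\<lambda>v. a (\<alpha> v)) (\<lambda>v. e (m (\<beta> y) v))"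
   "quad (vec x) (cov a) (vec y) (cov e)
     = \<Delta> y (\<lambda>v. e (\<alpha> v)) (\<lambda>v. a (m v (\<beta> x)))
       + \<Delta> x (\<lambda>v. a (\<alpha> v)) (\<lambda>v. e (m v (\<beta> y)))"
   "quad (cov a) (vec x) (cov e) (vec y)
     = \<Delta> y (\<lambda>v. a (m (\<beta> x) v)) (\<lambda>v. e (\<alpha> v))
       + \<Delta> x (\<lambda>v. e (m (\<beta> y) v)) (\<lambda>v. a (\<alpha> v))"
   "quad (cov a) (vec x) (vec y) (cov e)
     = \<Delta> x (\<lambda>v. e (m v (\<beta> y))) (\<lambda>v. a (\<alpha> v))
       + \<Delta> y (\<lambda>v. e (\<alpha> v)) (\<lambda>v. a (m (\<beta> x) v))"
proof -
  have g: "\<gamma> (\<lambda>v. c (\<alpha> v)) = c" for c :: "'a \<Rightarrow> 'f" by (simp add: fun_eq_iff \<gamma>_apply)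
  have r: "\<rho>1 x c (\<rho>2 d y) = \<Delta> y (\<lambda>v. c (m v (\<beta> x))) (\<lambda>v. d (\<alpha> v))"
     "\<rho>1 x c (\<mu>2 d y) = \<Delta> y (\<lambda>v. d (\<alpha> v)) (\<lambda>v. c (m v (\<beta> x)))"
     "\<mu>1 x c (\<rho>2 d y) = \<Delta> y (\<lambda>v. c (m (\<beta> x) v)) (\<lambda>v. d (\<alpha> v))"
     "\<mu>1 x c (\<mu>2 d y) = \<Delta> y (\<lambda>v. d (\<alpha> v)) (\<lambda>v. c (m (\<beta> x) v))"
    if cd: "c \<in> D" "d \<in> D" for c d x y
  proof -
    have e: "\<rho>1 x c = \<gamma> (\<gamma> (\<lambda>v. c (m v (\<beta> x))))" "\<mu>1 x c = \<gamma> (\<gamma> (\<lambda>v. c (m (\<beta> x) v)))"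
      by (simp_all add: fun_eq_iff \<gamma>_apply \<rho>1_apply \<mu>1_apply)
    \<comment> \<open>writing all functionals as twists lets \<open>\<Delta>_\<alpha>\<close> remove the twist of the vector\<close>
    have dd: "\<gamma> d = \<gamma> (\<gamma> (\<lambda>v. d (\<alpha> v)))" by (simp add: g)
    note cl = dual_comp \<gamma>_closed cd
    show "\<rho>1 x c (\<rho>2 d y) = \<Delta> y (\<lambda>v. c (m v (\<beta> x))) (\<lambda>v. d (\<alpha> v))"
     "\<rho>1 x c (\<mu>2 d y) = \<Delta> y (\<lambda>v. d (\<alpha> v)) (\<lambda>v. c (m v (\<beta> x)))"
     "\<mu>1 x c (\<rho>2 d y) = \<Delta> y (\<lambda>v. c (m (\<beta> x) v)) (\<lambda>v. d (\<alpha> v))"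
     "\<mu>1 x c (\<mu>2 d y) = \<Delta> y (\<lambda>v. d (\<alpha> v)) (\<lambda>v. c (m (\<beta> x) v))"
      unfolding \<rho>2_pairing[OF cd(2) action1_closed(1)[OF cd(1)]]
        \<mu>2_pairing[OF cd(2) action1_closed(1)[OF cd(1)]]
        \<rho>2_pairing[OF cd(2) action1_closed(2)[OF cd(1)]]
        \<mu>2_pairing[OF cd(2) action1_closed(2)[OF cd(1)]]
      unfolding e dd by (simp_all add: \<Delta>_\<alpha> cl)
  qed
  show "quad (vec x) (vec y) (cov a) (cov e) = \<Delta> (m x y) a e"
   "quad (vec x) (cov a) (cov e) (vec y)
     = \<Delta> y (\<lambda>v. a (m v (\<beta> x))) (\<lambda>v. e (\<alpha> v))
       + \<Delta> x (\<lambda>v. a (\<alpha> v)) (\<lambda>v. e (m (\<beta> y) v))"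
   "quad (vec x) (cov a) (vec y) (cov e)
     = \<Delta> y (\<lambda>v. e (\<alpha> v)) (\<lambda>v. a (m v (\<beta> x)))
       + \<Delta> x (\<lambda>v. a (\<alpha> v)) (\<lambda>v. e (m v (\<beta> y)))"
   "quad (cov a) (vec x) (cov e) (vec y)
     = \<Delta> y (\<lambda>v. a (m (\<beta> x) v)) (\<lambda>v. e (\<alpha> v))
       + \<Delta> x (\<lambda>v. e (m (\<beta> y) v)) (\<lambda>v. a (\<alpha> v))"
   "quad (cov a) (vec x) (vec y) (cov e)
     = \<Delta> x (\<lambda>v. e (m v (\<beta> y))) (\<lambda>v. a (\<alpha> v))
       + \<Delta> y (\<lambda>v. e (\<alpha> v)) (\<lambda>v. a (m (\<beta> x) v))"
    using assms by (simp_all add: quad_def pairing_def pure r n_apply \<Delta>_zero)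
qed

lemma tensor_eq_iff:
  assumes "\<And>\<xi> \<eta>. \<xi> \<notin> D \<or> \<eta> \<notin> D \<Longrightarrow> S \<xi> \<eta> = T \<xi> \<eta>"
  shows "S = T \<longleftrightarrow> (\<forall>\<xi>\<in>D. \<forall>\<eta>\<in>D. S \<xi> \<eta> = T \<xi> \<eta>)"
  using assms by (metis ext)

lemma \<Delta>_off: "\<xi> \<notin> D \<or> \<eta> \<notin> D \<Longrightarrow> \<Delta> x \<xi> \<eta> = 0"
  using \<Delta>_tensor[of x] by (auto simp: tensor_square_def)

lemmas tensor_simps = tensor_map_def tensor_scale_def tensor_flip_def dual_map_def Rmul_def Lmul_def

lemma coproduct_equation_xya_iff:
   "\<Delta> (m x y)
          - tensor_map scale (Rmul m (\<beta> y)) \<alpha> (\<Delta> x)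
          - tensor_map scale \<alpha> (Lmul m (\<beta> x)) (\<Delta> y)
        = tensor_scale (1/3)
           (tensor_map scale (Lmul m (\<beta> y)) \<alpha> (\<Delta> x)
            - tensor_map scale \<alpha> (Lmul m (\<beta> y)) (\<Delta> x)
            + tensor_map scale (Lmul m (\<beta> x)) \<alpha> (\<Delta> y)
            - tensor_map scale (Rmul m (\<beta> x)) \<alpha> (\<Delta> y)
            + tensor_flip
               (- \<Delta> (m x y)
                + tensor_map scale (Lmul m (\<beta> x)) \<alpha> (\<Delta> y)
                + tensor_map scale (Lmul m (\<beta> y)) \<alpha> (\<Delta> x)))
     \<longleftrightarrow> (\<forall>a\<in>D. \<forall>e\<in>D. J (vec x) (vec y) (cov a) (cov e))" (is "?S = ?T \<longleftrightarrow> _")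
proof -
  have "?S = ?T \<longleftrightarrow> (\<forall>a\<in>D. \<forall>e\<in>D. ?S a e = ?T a e)"
    by (rule tensor_eq_iff) (auto simp: tensor_simps \<Delta>_off)
  also have "\<dots> \<longleftrightarrow> (\<forall>a\<in>D. \<forall>e\<in>D. J (vec x) (vec y) (cov a) (cov e))"
    by (intro ball_cong refl)
      (auto simp: cyclic_identity_def quad_values tensor_simps algebra_simps add_divide_distrib
        diff_divide_distrib)
  finally show ?thesis .
qed

text \<open>
  Here the covectors are exchanged: the equation at \<open>(e, a)\<close> is the relation for \<open>a, x, y\<close> with \<open>e\<close>
  last.
\<close>

lemma coproduct_equation_axy_iff:
   "\<Delta> (m x y)
          - tensor_map scale (Rmul m (\<beta> y)) \<alpha> (\<Delta> x)
          - tensor_map scale \<alpha> (Lmul m (\<beta> x)) (\<Delta> y)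
        = tensor_scale (1/3)
           (tensor_flip
               (tensor_map scale (Lmul m (\<beta> x)) \<alpha> (\<Delta> y)
                + tensor_map scale (Lmul m (\<beta> y)) \<alpha> (\<Delta> x)
                - tensor_map scale (Rmul m (\<beta> y)) \<alpha> (\<Delta> x)
                - tensor_map scale \<alpha> (Lmul m (\<beta> x)) (\<Delta> y))
            - \<Delta> (m y x)
            + tensor_map scale (Lmul m (\<beta> x)) \<alpha> (\<Delta> y)
            + tensor_map scale (Lmul m (\<beta> y)) \<alpha> (\<Delta> x))
     \<longleftrightarrow> (\<forall>a\<in>D. \<forall>e\<in>D. J (cov a) (vec x) (vec y) (cov e))" (is "?S = ?T \<longleftrightarrow> _")
proof -
  have "?S = ?T \<longleftrightarrow> (\<forall>e\<in>D. \<forall>a\<in>D. ?S e a = ?T e a)"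
    by (rule tensor_eq_iff) (auto simp: tensor_simps \<Delta>_off)
  also have "\<dots> \<longleftrightarrow> (\<forall>e\<in>D. \<forall>a\<in>D. J (cov a) (vec x) (vec y) (cov e))"
    by (intro ball_cong refl)
      (auto simp: cyclic_identity_def quad_values tensor_simps algebra_simps add_divide_distrib
        diff_divide_distrib)
  finally show ?thesis by blast
qed

lemma coproduct_equation_xay_iff:
   "tensor_map scale \<alpha> (Rmul m (\<beta> y)) (\<Delta> x)
          - tensor_map scale (Lmul m (\<beta> y)) \<alpha> (\<Delta> x)
          + tensor_flip
             (tensor_map scale \<alpha> (Rmul m (\<beta> x)) (\<Delta> y)
              - tensor_map scale (Lmul m (\<beta> x)) \<alpha> (\<Delta> y))
        = tensor_scale (1/3)
           (tensor_map scale (Rmul m (\<beta> y)) \<alpha> (\<Delta> x)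
            - tensor_map scale \<alpha> (Lmul m (\<beta> y)) (\<Delta> x)
            + tensor_map scale \<alpha> (Lmul m (\<beta> x)) (\<Delta> y)
            - tensor_map scale (Rmul m (\<beta> x)) \<alpha> (\<Delta> y)
            + tensor_flip (\<Delta> (m y x) - \<Delta> (m x y)))
     \<longleftrightarrow> (\<forall>a\<in>D. \<forall>e\<in>D. J (vec x) (cov a) (vec y) (cov e))" (is "?S = ?T \<longleftrightarrow> _")
proof -
  have "?S = ?T \<longleftrightarrow> (\<forall>a\<in>D. \<forall>e\<in>D. ?S a e = ?T a e)"
    by (rule tensor_eq_iff) (auto simp: tensor_simps \<Delta>_off)
  also have "\<dots> \<longleftrightarrow> (\<forall>a\<in>D. \<forall>e\<in>D. J (vec x) (cov a) (vec y) (cov e))"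
    by (intro ball_cong refl)
      (auto simp: cyclic_identity_def quad_values tensor_simps algebra_simps add_divide_distrib
        diff_divide_distrib)
  finally show ?thesis .
qed

end

theorem theorem4p4:
  fixes scale :: "'f::field \<Rightarrow> 'a::ab_group_add \<Rightarrow> 'a"
    and m :: "'a \<Rightarrow> 'a \<Rightarrow> 'a"
    and \<alpha> :: "'a \<Rightarrow> 'a"
    and \<Delta> :: "'a \<Rightarrow> ('a \<Rightarrow> 'f) \<Rightarrow> ('a \<Rightarrow> 'f) \<Rightarrow> 'f"
  assumes "(3::'f) \<noteq> 0"
    and "regular_admissible_hom_poisson scale UNIV m \<alpha>"
    and "linear_map_on scale UNIV tensor_scale (tensor_square scale) \<Delta>"
    and "admissible_hom_poisson fun_scale (dual_space scale) (coproduct_dual \<Delta>) (dual_map (inv \<alpha>))"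
  shows "matched_pair scale UNIV m fun_scale (dual_space scale) (coproduct_dual \<Delta>)
           (\<lambda>x \<xi>. - Rstar m \<alpha> x \<xi>) (\<lambda>x \<xi>. - Lstar m \<alpha> x \<xi>)
           (\<lambda>\<xi> x. - Rstar_dual scale (coproduct_dual \<Delta>) \<alpha> \<xi> x)
           (\<lambda>\<xi> x. - Lstar_dual scale (coproduct_dual \<Delta>) \<alpha> \<xi> x)
           \<alpha> (dual_map (inv \<alpha>))
     \<longleftrightarrow>
     (\<forall>x y.
        \<Delta> (m x y)
          - tensor_map scale (Rmul m (inv \<alpha> y)) \<alpha> (\<Delta> x)
          - tensor_map scale \<alpha> (Lmul m (inv \<alpha> x)) (\<Delta> y)
        = tensor_scale (1/3)
           (tensor_map scale (Lmul m (inv \<alpha> y)) \<alpha> (\<Delta> x)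
            - tensor_map scale \<alpha> (Lmul m (inv \<alpha> y)) (\<Delta> x)
            + tensor_map scale (Lmul m (inv \<alpha> x)) \<alpha> (\<Delta> y)
            - tensor_map scale (Rmul m (inv \<alpha> x)) \<alpha> (\<Delta> y)
            + tensor_flip
               (- \<Delta> (m x y)
                + tensor_map scale (Lmul m (inv \<alpha> x)) \<alpha> (\<Delta> y)
                + tensor_map scale (Lmul m (inv \<alpha> y)) \<alpha> (\<Delta> x))))
     \<and>
     (\<forall>x y.
        \<Delta> (m x y)
          - tensor_map scale (Rmul m (inv \<alpha> y)) \<alpha> (\<Delta> x)
          - tensor_map scale \<alpha> (Lmul m (inv \<alpha> x)) (\<Delta> y)
        = tensor_scale (1/3)
           (tensor_flip
               (tensor_map scale (Lmul m (inv \<alpha> x)) \<alpha> (\<Delta> y)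
                + tensor_map scale (Lmul m (inv \<alpha> y)) \<alpha> (\<Delta> x)
                - tensor_map scale (Rmul m (inv \<alpha> y)) \<alpha> (\<Delta> x)
                - tensor_map scale \<alpha> (Lmul m (inv \<alpha> x)) (\<Delta> y))
            - \<Delta> (m y x)
            + tensor_map scale (Lmul m (inv \<alpha> x)) \<alpha> (\<Delta> y)
            + tensor_map scale (Lmul m (inv \<alpha> y)) \<alpha> (\<Delta> x)))
     \<and>
     (\<forall>x y.
        tensor_map scale \<alpha> (Rmul m (inv \<alpha> y)) (\<Delta> x)
          - tensor_map scale (Lmul m (inv \<alpha> y)) \<alpha> (\<Delta> x)
          + tensor_flip
             (tensor_map scale \<alpha> (Rmul m (inv \<alpha> x)) (\<Delta> y)
              - tensor_map scale (Lmul m (inv \<alpha> x)) \<alpha> (\<Delta> y))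
        = tensor_scale (1/3)
           (tensor_map scale (Rmul m (inv \<alpha> y)) \<alpha> (\<Delta> x)
            - tensor_map scale \<alpha> (Lmul m (inv \<alpha> y)) (\<Delta> x)
            + tensor_map scale \<alpha> (Lmul m (inv \<alpha> x)) (\<Delta> y)
            - tensor_map scale (Rmul m (inv \<alpha> x)) \<alpha> (\<Delta> y)
            + tensor_flip (\<Delta> (m y x) - \<Delta> (m x y))))"
proof -
  interpret hom_poisson_dual_double scale m \<alpha> \<Delta>
    using assms by unfold_locales
  show ?thesis
    using matched_pair_iff unfolding \<rho>1_def \<mu>1_def \<rho>2_def \<mu>2_def
    by (simp only: coproduct_equation_xya_iff coproduct_equation_axy_iff coproduct_equation_xay_iff)
qed

end
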